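(* Let a statistical model be defined by its factored joint probability (mass or density) function $p(x,y)=p(x)p(y|x)$, where $x$ is the latent variable and $y$ is the observable variable (both can be vectors). Let the model be conditioned on a set $\pmb{y}^*=\{y_1^*,\dots,y_{N^*}^*\}$ of $N^*$ observations, and let $\pmb{x}^*=\{x_1^*,\dots,x_S^*\}$ be a set of $S$ i.i.d. samples from the posterior $p(x|\pmb{y}^* )$. Let $\hat{\pmb{y}}=\{\hat y_1,\dots,\hat y_{\hat N}\}$ be a given set of $\hat N$ virtual observations. Let $\pmb{w}\in\mathbb{R}^{\hat N}$ be the weights, subject to $\sum_{i=1}^{\hat N}w_i=N^*$, that minimize the KL divergence $\mathrm{KL}\left(p(x|\pmb{y}^* )\,\|\,p(x|\hat{\pmb{y}},\pmb{w})\right)$ between the original posterior and the posterior reconstructed from the weighted virtual observations. Then $\pmb{w}$ is Monte Carlo approximated by a solution of $$\begin{aligned}\pmb{w}\approx\ &\arg\max\ \frac1S\sum_{s=1}^S\sum_{i=1}^{\hat N}w_i\log p(\hat y_i|x_s^* )\\&-\log\sum_{s=1}^S\exp\left(\sum_{i=1}^{\hat N}w_i\log p(\hat y_i|x_s^* )-\sum_{i=1}^{N^*}\log p(y_i^*|x_s^* )\right)\\&\text{s.t. }\sum_{i=1}^{\hat N}w_i=N^*,\end{aligned}$$ and the approximation tends to the exact solution as $S\to\infty$.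
   Context: Observations are conditionally independent given $x$: $p(\pmb{y}^*|x)=\prod_{i=1}^{N^*}p(y_i^*|x)$, and $p(x|\pmb{y}^* )\propto p(x)p(\pmb{y}^*|x)$. The probability of the weights given $x$ is defined as $$p(\pmb{w}|x)=h(\pmb{w})\prod_{i=1}^{\hat N}p(\hat y_i|x)^{w_i}=\exp\left(\log h(\pmb{w})+\sum_{i=1}^{\hat N}w_i\log p(\hat y_i|x)\right),$$ where $h(\pmb{w})$ is a base measure over $\pmb{w}$ (not depending on $x$). The reconstructed posterior is $p(x|\hat{\pmb{y}},\pmb{w})=p(x|\pmb{w})=p(\pmb{w}|x)p(x)/p(\pmb{w})$ with $p(\pmb{w})=\int p(\pmb{w}|x)p(x)\,dx$. "Monte Carlo approximated" means that expectations over $x\sim p(x|\pmb{y}^* )$ are replaced by averages over the samples $x_1^*,\dots,x_S^*$ (up to additive constants not depending on $\pmb{w}$).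
   Formalization: Added: the likelihoods of observed and virtual observations are positive for almost every x of positive prior density (else posterior samples can miss part of p(w) and the claim fails), h(w)>0 on the constraint set, p(y* ) is finite, and the log-likelihoods have finite posterior expectations. *)

theory Defs
  imports "HOL-Probability.Probability"
begin

text \<open>
  Densities are taken with respect to reference measures \<open>LX\<close> (latent space) and \<open>LY\<close>
  (observation space), so that counting measures give mass functions and Lebesgue measure gives
  probability densities.  \<open>px x\<close> is \<open>p(x)\<close> and \<open>lik y x\<close> is \<open>p(y|x)\<close>.  The observations are
  \<open>ys 0, \<dots>, ys (N - 1)\<close>; the virtual observations \<open>yh i\<close> are indexed by the same finite type as
  the components of the weight vector.
\<close>

locale statistical_model =
  LX: sigma_finite_measure LX + LY: sigma_finite_measure LY
  for LX :: "'x measure" and LY :: "'y measure" +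
  fixes px :: "'x \<Rightarrow> real" and lik :: "'y \<Rightarrow> 'x \<Rightarrow> real"
  assumes px_measurable: "px \<in> borel_measurable LX"
    and px_nonneg: "\<And>x. x \<in> space LX \<Longrightarrow> 0 \<le> px x"
    and px_normalized: "(\<integral>\<^sup>+ x. ennreal (px x) \<partial>LX) = 1"
    and lik_measurable: "(\<lambda>(x, y). lik y x) \<in> borel_measurable (LX \<Otimes>\<^sub>M LY)"
    and lik_nonneg: "\<And>x y. x \<in> space LX \<Longrightarrow> y \<in> space LY \<Longrightarrow> 0 \<le> lik y x"
    and lik_normalized: "\<And>x. x \<in> space LX \<Longrightarrow> (\<integral>\<^sup>+ y. ennreal (lik y x) \<partial>LY) = 1"

definition obs_lik :: "('y \<Rightarrow> 'x \<Rightarrow> real) \<Rightarrow> nat \<Rightarrow> (nat \<Rightarrow> 'y) \<Rightarrow> 'x \<Rightarrow> real" where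
  "obs_lik lik N ys x = (\<Prod>j<N. lik (ys j) x)"

definition evidence ::
  "'x measure \<Rightarrow> ('x \<Rightarrow> real) \<Rightarrow> ('y \<Rightarrow> 'x \<Rightarrow> real) \<Rightarrow> nat \<Rightarrow> (nat \<Rightarrow> 'y) \<Rightarrow> real" where
  "evidence LX px lik N ys = (\<integral>x. px x * obs_lik lik N ys x \<partial>LX)"

definition posterior ::
  "'x measure \<Rightarrow> ('x \<Rightarrow> real) \<Rightarrow> ('y \<Rightarrow> 'x \<Rightarrow> real) \<Rightarrow> nat \<Rightarrow> (nat \<Rightarrow> 'y) \<Rightarrow> 'x measure" where
  "posterior LX px lik N ys =
     density LX (\<lambda>x. ennreal (px x * obs_lik lik N ys x / evidence LX px lik N ys))"

definition weight_lik ::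
  "('y \<Rightarrow> 'x \<Rightarrow> real) \<Rightarrow> (real^'n \<Rightarrow> real) \<Rightarrow> ('n::finite \<Rightarrow> 'y) \<Rightarrow> real^'n \<Rightarrow> 'x \<Rightarrow> real" where
  "weight_lik lik h yh w x = h w * (\<Prod>i\<in>UNIV. lik (yh i) x powr (w $ i))"

definition weight_evidence ::
  "'x measure \<Rightarrow> ('x \<Rightarrow> real) \<Rightarrow> ('y \<Rightarrow> 'x \<Rightarrow> real) \<Rightarrow> (real^'n \<Rightarrow> real) \<Rightarrow> ('n::finite \<Rightarrow> 'y)
     \<Rightarrow> real^'n \<Rightarrow> real" where
  "weight_evidence LX px lik h yh w = (\<integral>x. weight_lik lik h yh w x * px x \<partial>LX)"

definition recon_posterior ::
  "'x measure \<Rightarrow> ('x \<Rightarrow> real) \<Rightarrow> ('y \<Rightarrow> 'x \<Rightarrow> real) \<Rightarrow> (real^'n \<Rightarrow> real) \<Rightarrow> ('n::finite \<Rightarrow> 'y)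
     \<Rightarrow> real^'n \<Rightarrow> 'x measure" where
  "recon_posterior LX px lik h yh w =
     density LX (\<lambda>x. ennreal (weight_lik lik h yh w x * px x / weight_evidence LX px lik h yh w))"

definition feasible :: "nat \<Rightarrow> real^'n::finite \<Rightarrow> bool" where
  "feasible N w \<longleftrightarrow> (\<Sum>i\<in>UNIV. w $ i) = real N"

text \<open>The reconstructed posterior exists only if the normalising constant \<open>p(w)\<close> is finite.\<close>

definition proper_weights ::
  "'x measure \<Rightarrow> ('x \<Rightarrow> real) \<Rightarrow> ('y \<Rightarrow> 'x \<Rightarrow> real) \<Rightarrow> (real^'n \<Rightarrow> real) \<Rightarrow> ('n::finite \<Rightarrow> 'y)
     \<Rightarrow> real^'n \<Rightarrow> bool" where
  "proper_weights LX px lik h yh w \<longleftrightarrow> integrable LX (\<lambda>x. weight_lik lik h yh w x * px x)"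

text \<open>
  In the library, \<open>KL_divergence b M N\<close> is the divergence usually written \<open>KL(N || M)\<close>: the
  expectation is taken under the last argument.
\<close>

definition recon_KL ::
  "'x measure \<Rightarrow> ('x \<Rightarrow> real) \<Rightarrow> ('y \<Rightarrow> 'x \<Rightarrow> real) \<Rightarrow> (real^'n \<Rightarrow> real) \<Rightarrow> nat \<Rightarrow> (nat \<Rightarrow> 'y)
     \<Rightarrow> ('n::finite \<Rightarrow> 'y) \<Rightarrow> real^'n \<Rightarrow> real" where
  "recon_KL LX px lik h N ys yh w =
     KL_divergence (exp 1) (recon_posterior LX px lik h yh w) (posterior LX px lik N ys)"

definition exact_solution ::
  "'x measure \<Rightarrow> ('x \<Rightarrow> real) \<Rightarrow> ('y \<Rightarrow> 'x \<Rightarrow> real) \<Rightarrow> (real^'n \<Rightarrow> real) \<Rightarrow> nat \<Rightarrow> (nat \<Rightarrow> 'y)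
     \<Rightarrow> ('n::finite \<Rightarrow> 'y) \<Rightarrow> real^'n \<Rightarrow> bool" where
  "exact_solution LX px lik h N ys yh =
     is_arg_min (recon_KL LX px lik h N ys yh)
       (\<lambda>w. feasible N w \<and> proper_weights LX px lik h yh w)"

definition mc_objective ::
  "('y \<Rightarrow> 'x \<Rightarrow> real) \<Rightarrow> nat \<Rightarrow> (nat \<Rightarrow> 'y) \<Rightarrow> ('n::finite \<Rightarrow> 'y) \<Rightarrow> nat \<Rightarrow> (nat \<Rightarrow> 'x)
     \<Rightarrow> real^'n \<Rightarrow> real" where
  "mc_objective lik N ys yh S xs w =
     1 / real S * (\<Sum>s<S. \<Sum>i\<in>UNIV. w $ i * ln (lik (yh i) (xs s)))
     - ln (\<Sum>s<S. exp ((\<Sum>i\<in>UNIV. w $ i * ln (lik (yh i) (xs s)))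
                       - (\<Sum>j<N. ln (lik (ys j) (xs s)))))"

definition mc_solution ::
  "('y \<Rightarrow> 'x \<Rightarrow> real) \<Rightarrow> nat \<Rightarrow> (nat \<Rightarrow> 'y) \<Rightarrow> ('n::finite \<Rightarrow> 'y) \<Rightarrow> nat \<Rightarrow> (nat \<Rightarrow> 'x)
     \<Rightarrow> real^'n \<Rightarrow> bool" where
  "mc_solution lik N ys yh S xs = is_arg_max (mc_objective lik N ys yh S xs) (feasible N)"

text \<open>
  The objective as a function of an expectation operator \<open>E\<close>; it is used with the posterior
  expectation and with the average over a sample.
\<close>

definition objective ::
  "(('x \<Rightarrow> real) \<Rightarrow> real) \<Rightarrow> ('y \<Rightarrow> 'x \<Rightarrow> real) \<Rightarrow> nat \<Rightarrow> (nat \<Rightarrow> 'y) \<Rightarrow> ('n::finite \<Rightarrow> 'y)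
     \<Rightarrow> real^'n \<Rightarrow> real" where
  "objective E lik N ys yh w =
     E (\<lambda>x. \<Sum>i\<in>UNIV. w $ i * ln (lik (yh i) x))
     - ln (E (\<lambda>x. exp ((\<Sum>i\<in>UNIV. w $ i * ln (lik (yh i) x)) - (\<Sum>j<N. ln (lik (ys j) x)))))"

definition sample_average :: "nat \<Rightarrow> (nat \<Rightarrow> 'x) \<Rightarrow> ('x \<Rightarrow> real) \<Rightarrow> real" where
  "sample_average S xs f = (\<Sum>s<S. f (xs s)) / real S"

end

theory Submission
  imports Defs
begin

text \<open>
  Write \<open>l x\<close> for the vector of virtual log-likelihoods, \<open>b x\<close> for the log-likelihood of the
  observations and \<open>\<mu>\<close> for the posterior mean of \<open>l\<close>.  Up to an additive constant, the
  KL divergence is the logarithm of the posterior expectation of \<open>exp (w \<bullet> (l x - \<mu>) - b x)\<close> (the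
  risk), and the Monte Carlo objective is minus the logarithm of its empirical analogue, which is a
  convex function of \<open>w\<close>.

  The risk may be infinite near an optimum, so uniform convergence fails.  Consistency needs only
  two one-sided facts: the empirical risk converges at the fixed optimum \<open>w0\<close>, and along any
  convergent sequence its limit inferior is at least the risk of the limit.  Hence limits of
  minimizers are optimal.  If minimizers escape to infinity in the limiting direction \<open>u\<close>, convexity
  bounds the risk along the ray \<open>w0 + t u\<close>, which forces \<open>u \<bullet> l\<close> to be almost surely constant; such
  flat directions change neither risk and are projected away at the start.
\<close>

subsection \<open>The strong law of large numbers\<close>

text \<open>This is the running maximum of the partial sums of length at most \<open>n\<close>, the
  empty sum 0 included. The recursion splits off the first term, not the last, so that the shifted
  sequence appears in it.\<close>

primrec max_partial_sum :: "nat \<Rightarrow> (nat \<Rightarrow> real) \<Rightarrow> real" where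
  "max_partial_sum 0 y = 0"
| "max_partial_sum (Suc n) y = max 0 (y 0 + max_partial_sum n (\<lambda>i. y (Suc i)))"

lemma max_partial_sum_nonneg: "0 \<le> max_partial_sum n y"
  by (cases n) auto

lemma partial_sum_le_max_partial_sum: "k \<le> n \<Longrightarrow> (\<Sum>i<k. y i) \<le> max_partial_sum n y"
proof (induction n arbitrary: k y)
  case (Suc n)
  show ?case
  proof (cases k)
    case (Suc m)
    with Suc.IH[of m "\<lambda>i. y (Suc i)"] Suc.prems show ?thesis
      by (simp add: sum.lessThan_Suc_shift del: sum.lessThan_Suc)
  qed (simp add: max_partial_sum_nonneg)
qed simp

lemma max_partial_sum_mono: "max_partial_sum n y \<le> max_partial_sum (Suc n) y"
proof (induction n arbitrary: y)
  case (Suc n)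
  show ?case
    using Suc[of "\<lambda>i. y (Suc i)"] by simp
qed simp

text \<open>Measurability on the sequence space allows expectations to be computed from the joint
  law of the sequence, which is where shift invariance is available.\<close>

lemma max_partial_sum_measurable:
  "max_partial_sum n \<in> borel_measurable (\<Pi>\<^sub>M i\<in>UNIV. borel)"
proof (induction n)
  case 0
  have "max_partial_sum 0 = (\<lambda>y. 0)" by (rule ext) simp
  then show ?case by (metis borel_measurable_const)
next
  case (Suc n)
  have [measurable]: "(\<lambda>y i. y (Suc i)) \<in> measurable (\<Pi>\<^sub>M i\<in>UNIV. (borel :: real measure)) (\<Pi>\<^sub>M i\<in>UNIV. borel)"
    by (rule measurable_PiM_single') (auto simp: space_PiM)
  have "(\<lambda>y. max 0 (y 0 + max_partial_sum n (\<lambda>i. y (Suc i)))) \<in> borel_measurable (\<Pi>\<^sub>M i\<in>UNIV. borel)"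
    by (intro borel_measurable_max borel_measurable_const borel_measurable_add
        measurable_compose[OF _ Suc] measurable_component_singleton) auto
  moreover have "max_partial_sum (Suc n) = (\<lambda>y. max 0 (y 0 + max_partial_sum n (\<lambda>i. y (Suc i))))"
    by (rule ext) simp
  ultimately show ?case by metis
qed

lemma max_partial_sum_integrable:
  assumes "\<And>i. integrable M (Y i)"
  shows "integrable M (\<lambda>\<omega>. max_partial_sum n (\<lambda>i. Y i \<omega>))"
  using assms by (induction n arbitrary: Y) auto

text \<open>Independence means that the joint law is the product of the marginals. The shifted
  sequence is again independent with the same marginals, so both laws are the same product.\<close>

lemma (in prob_space) iid_distr_shift:
  fixes Y :: "nat \<Rightarrow> 'a \<Rightarrow> real"
  assumes ind: "indep_vars (\<lambda>_. borel) Y UNIV"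
    and same: "\<And>i. distr M borel (Y i) = D"
  shows "distr M (\<Pi>\<^sub>M i\<in>UNIV. borel) (\<lambda>\<omega> i. Y (Suc i) \<omega>) = distr M (\<Pi>\<^sub>M i\<in>UNIV. borel) (\<lambda>\<omega> i. Y i \<omega>)"
proof -
  have rv: "\<And>i. random_variable borel (Y i)"
    using ind by (auto simp: indep_vars_def)
  have ind': "indep_vars (\<lambda>_. borel) (\<lambda>i. Y (Suc i)) UNIV"
  proof -
    have "indep_sets (\<lambda>i. {Y (Suc i) -` A \<inter> space M |A. A \<in> sets borel}) UNIV"
      unfolding indep_sets_def
    proof (intro conjI ballI allI impI)
      fix J :: "nat set" and A
      assume J: "J \<noteq> {}" "finite J" and A: "A \<in> (\<Pi> j\<in>J. {Y (Suc j) -` A \<inter> space M |A. A \<in> sets borel})"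
      have "indep_sets (\<lambda>i. {Y i -` A \<inter> space M |A. A \<in> sets borel}) UNIV"
        using ind by (simp add: indep_vars_def2)
      moreover have "\<forall>j\<in>Suc ` J. A (j - 1) \<in> {Y j -` A \<inter> space M |A. A \<in> sets borel}"
      proof safe
        fix j assume "j \<in> J"
        with A have "A j \<in> {Y (Suc j) -` A \<inter> space M |A. A \<in> sets borel}" by (rule Pi_mem)
        then show "\<exists>B. A (Suc j - 1) = Y (Suc j) -` B \<inter> space M \<and> B \<in> sets borel" by simp
      qed
      ultimately have "prob (\<Inter>j\<in>Suc ` J. A (j - 1)) = (\<Prod>j\<in>Suc ` J. prob (A (j - 1)))"
        using J by (intro indep_setsD) blast+
      moreover have "(\<Prod>j\<in>Suc ` J. prob (A (j - 1))) = (\<Prod>j\<in>J. prob (A j))"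
        by (subst prod.reindex) (auto simp: comp_def)
      moreover have "(\<Inter>j\<in>Suc ` J. A (j - 1)) = \<Inter> (A ` J)"
        by auto
      ultimately show "prob (\<Inter> (A ` J)) = (\<Prod>j\<in>J. prob (A j))"
        by simp
    next
      fix i show "{Y (Suc i) -` A \<inter> space M |A. A \<in> sets borel} \<subseteq> events"
        using measurable_sets[OF rv[of "Suc i"]] by blast
    qed
    then show ?thesis
      unfolding indep_vars_def2 using rv by blast
  qed
  show ?thesis
    using ind ind' rv
    by (simp add: indep_vars_iff_distr_eq_PiM restrict_UNIV same)
qed

text \<open>Dropping the first \<open>k\<close> terms changes the partial sums by a bounded amount,
  so unboundedness depends only on the terms from \<open>k\<close> on, for every \<open>k\<close>,
  and is a tail event.\<close>

lemma (in prob_space) unbounded_partial_sums_0_1: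
  fixes Y :: "nat \<Rightarrow> 'a \<Rightarrow> real"
  assumes ind: "indep_vars (\<lambda>_. borel) Y UNIV"
  defines "U \<equiv> {\<omega> \<in> space M. \<forall>m::nat. \<exists>n. real m < (\<Sum>i<n. Y i \<omega>)}"
  shows "prob U = 0 \<or> prob U = 1"
proof (rule kolmogorov_0_1_law)
  let ?A = "\<lambda>i. sigma_sets (space M) {Y i -` A \<inter> space M |A. A \<in> sets borel}"
  show "sigma_algebra (space M) (?A i)" for i
    by (rule sigma_algebra_sigma_sets) auto
  show "indep_sets ?A UNIV"
    using ind by (simp add: indep_vars_def)
  show "U \<in> tail_events ?A"
    unfolding tail_events_def
  proof safe
    fix k
    let ?F = "sigma (space M) (\<Union> (?A ` {k..}))"
    have sub: "\<Union> (?A ` {k..}) \<subseteq> Pow (space M)"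
    proof (intro UN_least subsetI PowI)
      fix i x \<omega> assume "x \<in> ?A i" "\<omega> \<in> x"
      then show "\<omega> \<in> space M"
        using sigma_sets_into_sp[of "{Y i -` A \<inter> space M |A. A \<in> sets borel}" "space M" x] by auto
    qed
    have [measurable]: "Y i \<in> borel_measurable ?F" if "k \<le> i" for i
    proof (rule measurableI)
      fix A :: "real set" assume "A \<in> sets borel"
      then have "Y i -` A \<inter> space M \<in> \<Union> (?A ` {k..})"
        using that by (intro UN_I[of i]) (auto intro!: sigma_sets.Basic)
      then show "Y i -` A \<inter> space ?F \<in> sets ?F"
        using sub by (simp add: sigma_sets.Basic)
    qed simp
    have eq: "(\<forall>m::nat. \<exists>n. real m < (\<Sum>i<n. Y i \<omega>)) \<longleftrightarrow> (\<forall>m::nat. \<exists>n. real m < (\<Sum>i\<in>{k..<n}. Y i \<omega>))"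
      (is "?l \<longleftrightarrow> ?r") for \<omega>
    proof -
      \<comment> \<open>\<open>?B\<close> dominates the dropped sum in absolute value and every
        partial sum of length at most \<open>k\<close>. Raising the level by \<open>?B\<close>
        therefore absorbs the change and, for full sums, excludes \<open>n < k\<close>.\<close>
      let ?c = "\<Sum>i<k. Y i \<omega>" and ?B = "\<Sum>i<k. \<bar>Y i \<omega>\<bar>"
      have split: "(\<Sum>i<n. Y i \<omega>) = ?c + (\<Sum>i\<in>{k..<n}. Y i \<omega>)" if "k \<le> n" for n
        using that by (simp add: lessThan_atLeast0 sum.atLeastLessThan_concat)
      have small: "(\<Sum>i<n. Y i \<omega>) \<le> ?B" if "n \<le> k" for n
        using that
        by (intro order_trans[OF sum_mono sum_mono2]) auto
      have B: "?c \<le> ?B" "- ?c \<le> ?B"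
        using sum_abs[of "\<lambda>i. Y i \<omega>" "{..<k}"] by (auto simp: abs_le_iff)
      show ?thesis
      proof
        assume l: ?l
        show ?r
        proof
          fix m :: nat
          obtain m' :: nat where m': "real m + ?B \<le> real m'" using real_arch_simple by blast
          obtain n where n: "real m' < (\<Sum>i<n. Y i \<omega>)" using l by blast
          then have "k \<le> n" using small[of n] m' by (cases "k \<le> n") auto
          then show "\<exists>n. real m < (\<Sum>i\<in>{k..<n}. Y i \<omega>)"
            using split[of n] n m' B by (intro exI[of _ n]) linarith
        qed
      next
        assume r: ?r
        show ?l
        proof
          fix m :: nat
          obtain m' :: nat where m': "real m + ?B \<le> real m'" using real_arch_simple by blast
          obtain n where n: "real m' < (\<Sum>i\<in>{k..<n}. Y i \<omega>)" using r by blast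
          then have "k \<le> n" by (cases "k \<le> n") auto
          then show "\<exists>n. real m < (\<Sum>i<n. Y i \<omega>)"
            using split[of n] n m' B by (intro exI[of _ n]) linarith
        qed
      qed
    qed
    have "U = {\<omega> \<in> space ?F. \<forall>m::nat. \<exists>n. real m < (\<Sum>i\<in>{k..<n}. Y i \<omega>)}"
      using sub by (simp add: U_def eq)
    also have "\<dots> \<in> sets ?F"
      by measurable
    finally show "U \<in> sigma_sets (space M) (\<Union> (?A ` {k..}))"
      using sub by simp
  qed
qed

text \<open>With \<open>D n = max_partial_sum (Suc n) Y - max_partial_sum n Y'\<close>, \<open>Y'\<close> the shifted sequence,
  stationarity gives \<open>E (D n) \<ge> 0\<close>, while \<open>D n = max (- max_partial_sum n Y') (Y 0)\<close> tends to \<open>Y 0\<close>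
  on the event that the partial sums are unbounded above.  This event is trivial by the 0-1 law, so
  it is null if \<open>E (Y 0) < 0\<close>.\<close>

lemma (in prob_space) partial_sums_bounded_above:
  fixes Y :: "nat \<Rightarrow> 'a \<Rightarrow> real"
  assumes ind: "indep_vars (\<lambda>_. borel) Y UNIV"
    and same: "\<And>i. distr M borel (Y i) = D"
    and int: "\<And>i. integrable M (Y i)" and neg: "expectation (Y 0) < 0"
  shows "AE \<omega> in M. \<exists>C. \<forall>n. (\<Sum>i<n. Y i \<omega>) \<le> C"
proof -
  define U where "U = {\<omega> \<in> space M. \<forall>m::nat. \<exists>n. real m < (\<Sum>i<n. Y i \<omega>)}"
  have [measurable]: "\<And>i. random_variable borel (Y i)" using int by auto
  have U[measurable]: "U \<in> events" unfolding U_def by measurable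
  have "prob U \<noteq> 1"
  proof
    assume "prob U = 1"
    then have ae: "AE \<omega> in M. \<omega> \<in> U" using U by (simp add: AE_in_set_eq_1)
    define D where "D n \<omega> = max_partial_sum (Suc n) (\<lambda>i. Y i \<omega>) - max_partial_sum n (\<lambda>i. Y (Suc i) \<omega>)" for n \<omega>
    have D_eq: "D n \<omega> = max (- max_partial_sum n (\<lambda>i. Y (Suc i) \<omega>)) (Y 0 \<omega>)" for n \<omega>
      by (simp add: D_def)
    have i1: "integrable M (\<lambda>\<omega>. max_partial_sum n (\<lambda>i. Y i \<omega>))"
      and i2: "integrable M (\<lambda>\<omega>. max_partial_sum n (\<lambda>i. Y (Suc i) \<omega>))" for n
      using max_partial_sum_integrable[of M Y] max_partial_sum_integrable[of M "\<lambda>i. Y (Suc i)"] int by auto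
    have shift: "expectation (\<lambda>\<omega>. max_partial_sum n (\<lambda>i. Y (Suc i) \<omega>)) = expectation (\<lambda>\<omega>. max_partial_sum n (\<lambda>i. Y i \<omega>))" for n
    proof -
      have m: "(\<lambda>\<omega> i. Z i \<omega>) \<in> measurable M (\<Pi>\<^sub>M i\<in>UNIV. borel)"
        if "\<And>i. random_variable borel (Z i)" for Z :: "nat \<Rightarrow> 'a \<Rightarrow> real"
        by (rule measurable_PiM_single') (use that in \<open>auto simp: space_PiM\<close>)
      have "integral\<^sup>L (distr M (\<Pi>\<^sub>M i\<in>UNIV. borel) (\<lambda>\<omega> i. Y (Suc i) \<omega>)) (max_partial_sum n) =
        integral\<^sup>L (distr M (\<Pi>\<^sub>M i\<in>UNIV. borel) (\<lambda>\<omega> i. Y i \<omega>)) (max_partial_sum n)"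
        using iid_distr_shift[OF ind same] by simp
      then show ?thesis
        by (subst (asm) (1 2) integral_distr) (auto intro!: m max_partial_sum_measurable)
    qed
    have "0 \<le> expectation (D n)" for n
    proof -
      have "expectation (D n) = expectation (\<lambda>\<omega>. max_partial_sum (Suc n) (\<lambda>i. Y i \<omega>)) - expectation (\<lambda>\<omega>. max_partial_sum n (\<lambda>i. Y i \<omega>))"
        unfolding D_def using i1[of "Suc n"] i2[of n] by (subst Bochner_Integration.integral_diff) (simp_all only: shift)
      also have "\<dots> \<ge> 0"
        using integral_mono[OF i1[of n] i1[of "Suc n"] max_partial_sum_mono] by linarith
      finally show ?thesis .
    qed
    moreover have "(\<lambda>n. expectation (D n)) \<longlonglongrightarrow> expectation (Y 0)"
    proof (rule integral_dominated_convergence)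
      show "integrable M (\<lambda>\<omega>. \<bar>Y 0 \<omega>\<bar>)" using int by auto
      show "D n \<in> borel_measurable M" for n
        unfolding D_def using i1[of "Suc n"] i2[of n] by (intro borel_measurable_diff) auto
      \<comment> \<open>\<open>D n\<close> either equals \<open>Y 0\<close> or lies between
        \<open>Y 0\<close> and 0.\<close>
      show "AE \<omega> in M. norm (D n \<omega>) \<le> \<bar>Y 0 \<omega>\<bar>" for n
        unfolding D_eq using max_partial_sum_nonneg by (intro AE_I2) (smt (verit) real_norm_def)
      show "AE \<omega> in M. (\<lambda>n. D n \<omega>) \<longlonglongrightarrow> Y 0 \<omega>"
        using ae
      proof eventually_elim
        case (elim \<omega>)
        \<comment> \<open>Of the two copies of \<open>\<bar>Y 0 \<omega>\<bar>\<close>, one pays for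
          removing the first term and the other leaves a shifted sum of at least
          \<open>\<bar>Y 0 \<omega>\<bar>\<close>, so that the maximum defining \<open>D\<close> is
          attained by \<open>Y 0\<close>.\<close>
        obtain m :: nat where m: "\<bar>Y 0 \<omega>\<bar> + \<bar>Y 0 \<omega>\<bar> \<le> real m" using real_arch_simple by blast
        obtain n where n: "real m < (\<Sum>i<n. Y i \<omega>)" using elim by (auto simp: U_def)
        then have "n \<noteq> 0" by (cases n) auto
        then obtain k where k: "n = Suc k" by (cases n) auto
        have "\<bar>Y 0 \<omega>\<bar> \<le> (\<Sum>i<k. Y (Suc i) \<omega>)"
          using n m by (simp add: k sum.lessThan_Suc_shift del: sum.lessThan_Suc)
        then have "D j \<omega> = Y 0 \<omega>" if "k \<le> j" for j
          using partial_sum_le_max_partial_sum[OF that, of "\<lambda>i. Y (Suc i) \<omega>"] by (simp add: D_eq)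
        then show ?case
          by (intro tendsto_eventually) (auto simp: eventually_sequentially)
      qed
    qed simp
    ultimately have "0 \<le> expectation (Y 0)"
      by (intro LIMSEQ_le_const) auto
    with neg show False by simp
  qed
  then have "prob U = 0"
    using unbounded_partial_sums_0_1[OF ind] by (auto simp: U_def)
  then have "AE \<omega> in M. \<omega> \<notin> U"
    using U by (simp add: prob_eq_0)
  then show ?thesis
    by (rule AE_mp) (auto simp: U_def not_less intro!: AE_I2)
qed

text \<open>Subtracting slightly more than the mean makes the drift negative, so the partial sums
  are bounded by some \<open>C\<close>, and \<open>C / n\<close> vanishes. The excesses
  \<open>1 / (m + 1)\<close> are countably many and share one null set.\<close>

lemma (in prob_space) strong_law_upper:
  fixes Y :: "nat \<Rightarrow> 'a \<Rightarrow> real"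
  assumes ind: "indep_vars (\<lambda>_. borel) Y UNIV"
    and same: "\<And>i. distr M borel (Y i) = D"
    and int: "\<And>i. integrable M (Y i)" and mean: "expectation (Y 0) = \<mu>"
  shows "AE \<omega> in M. \<forall>e>0. eventually (\<lambda>n. (\<Sum>i<n. Y i \<omega>) / real n < \<mu> + e) sequentially"
proof -
  have "AE \<omega> in M. \<forall>m::nat. \<exists>C. \<forall>n. (\<Sum>i<n. Y i \<omega> - (\<mu> + inverse (real (Suc m)))) \<le> C"
  proof (subst AE_all_countable, rule allI, rule partial_sums_bounded_above)
    fix m :: nat
    let ?c = "\<mu> + inverse (real (Suc m))"
    show "indep_vars (\<lambda>_. borel) (\<lambda>i \<omega>. Y i \<omega> - ?c) UNIV"
      by (rule indep_vars_compose2[OF ind]) auto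
    show "distr M borel (\<lambda>\<omega>. Y i \<omega> - ?c) = distr D borel (\<lambda>y. y - ?c)" for i
      using int[of i] by (subst same[symmetric, of i], subst distr_distr) (auto simp: comp_def)
    show "integrable M (\<lambda>\<omega>. Y i \<omega> - ?c)" for i using int by auto
    show "expectation (\<lambda>\<omega>. Y 0 \<omega> - ?c) < 0"
      using int[of 0] mean by (simp add: prob_space)
  qed
  then show ?thesis
  proof eventually_elim
    case (elim \<omega>)
    show ?case
    proof safe
      fix e :: real assume "0 < e"
      then obtain m where m: "inverse (real (Suc m)) < e / 2"
        using reals_Archimedean[of "e / 2"] by auto
      obtain C where C: "\<And>n. (\<Sum>i<n. Y i \<omega> - (\<mu> + inverse (real (Suc m)))) \<le> C"
        using elim by blast
      have "(\<lambda>n. C / real n) \<longlonglongrightarrow> 0" by (rule lim_const_over_n)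
      then have "eventually (\<lambda>n. C / real n < e / 2) sequentially"
        using \<open>0 < e\<close> by (intro order_tendstoD) auto
      then show "eventually (\<lambda>n. (\<Sum>i<n. Y i \<omega>) / real n < \<mu> + e) sequentially"
        using eventually_gt_at_top[of 0]
      proof eventually_elim
        case (elim n)
        have "(\<Sum>i<n. Y i \<omega>) \<le> C + real n * (\<mu> + inverse (real (Suc m)))"
          using C[of n] by (simp add: sum_subtractf)
        then have "(\<Sum>i<n. Y i \<omega>) / real n \<le> (C + real n * (\<mu> + inverse (real (Suc m)))) / real n"
          by (rule divide_right_mono) simp
        also have "\<dots> = C / real n + (\<mu> + inverse (real (Suc m)))"
          using \<open>0 < n\<close> by (simp only: add_divide_distrib[of C]) simp
        finally have "(\<Sum>i<n. Y i \<omega>) / real n \<le> C / real n + (\<mu> + inverse (real (Suc m)))" .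
        then show ?case using elim m by linarith
      qed
    qed
  qed
qed

text \<open>The lower bound is the upper bound applied to \<open>- Y i\<close>.\<close>

theorem (in prob_space) strong_law_of_large_numbers:
  fixes Y :: "nat \<Rightarrow> 'a \<Rightarrow> real"
  assumes ind: "indep_vars (\<lambda>_. borel) Y UNIV"
    and same: "\<And>i. distr M borel (Y i) = D"
    and int: "\<And>i. integrable M (Y i)"
  shows "AE \<omega> in M. (\<lambda>n. (\<Sum>i<n. Y i \<omega>) / real n) \<longlonglongrightarrow> expectation (Y 0)"
proof -
  have neg: "AE \<omega> in M. \<forall>e>0. eventually (\<lambda>n. (\<Sum>i<n. - Y i \<omega>) / real n < - expectation (Y 0) + e) sequentially"
  proof (rule strong_law_upper)
    show "indep_vars (\<lambda>_. borel) (\<lambda>i \<omega>. - Y i \<omega>) UNIV"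
      by (rule indep_vars_compose2[OF ind]) auto
    show "distr M borel (\<lambda>\<omega>. - Y i \<omega>) = distr D borel uminus" for i
      using int[of i] by (subst same[symmetric, of i], subst distr_distr) (auto simp: comp_def)
  qed (use int in auto)
  show ?thesis
    using strong_law_upper[OF ind same int refl] neg
  proof eventually_elim
    case (elim \<omega>)
    show ?case
    proof (rule LIMSEQ_I)
      fix e :: real assume "0 < e"
      with elim have "eventually (\<lambda>n. (\<Sum>i<n. Y i \<omega>) / real n < expectation (Y 0) + e \<and>
          (\<Sum>i<n. - Y i \<omega>) / real n < - expectation (Y 0) + e) sequentially"
        by (intro eventually_conj) auto
      then have "eventually (\<lambda>n. norm ((\<Sum>i<n. Y i \<omega>) / real n - expectation (Y 0)) < e) sequentially"
        by eventually_elim (auto simp: sum_negf abs_less_iff)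
      then show "\<exists>N. \<forall>n\<ge>N. norm ((\<Sum>i<n. Y i \<omega>) / real n - expectation (Y 0)) < e"
        by (simp add: eventually_sequentially)
    qed
  qed
qed

lemma (in prob_space) strong_law_sample:
  fixes f :: "'b \<Rightarrow> real"
  assumes ind: "indep_vars (\<lambda>_. L) X UNIV" and distr: "\<And>s. distr M L (X s) = P"
    and f: "integrable P f"
  shows "AE \<omega> in M. (\<lambda>S. (\<Sum>s<S. f (X s \<omega>)) / real S) \<longlonglongrightarrow> integral\<^sup>L P f"
proof -
  have X[measurable]: "\<And>s. X s \<in> measurable M L" using ind by (auto simp: indep_vars_def)
  have "sets P = sets L" using distr[of 0] by auto
  then have f'[measurable]: "f \<in> borel_measurable L"
    using f by (auto simp: cong: measurable_cong_sets)
  have "AE \<omega> in M. (\<lambda>n. (\<Sum>i<n. f (X i \<omega>)) / real n) \<longlonglongrightarrow> expectation (\<lambda>\<omega>. f (X 0 \<omega>))"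
  proof (rule strong_law_of_large_numbers)
    show "indep_vars (\<lambda>_. borel) (\<lambda>i \<omega>. f (X i \<omega>)) UNIV"
      by (rule indep_vars_compose2[OF ind]) auto
    show "distr M borel (\<lambda>\<omega>. f (X i \<omega>)) = distr P borel f" for i
      by (subst distr[symmetric, of i], subst distr_distr) (auto simp: comp_def)
    show "integrable M (\<lambda>\<omega>. f (X i \<omega>))" for i
    proof -
      have "integrable (distr M L (X i)) f" using f distr by simp
      then show ?thesis by (simp add: integrable_distr_eq)
    qed
  qed
  also have "expectation (\<lambda>\<omega>. f (X 0 \<omega>)) = integral\<^sup>L P f"
    using integral_distr[of "X 0" M L f] distr[of 0] by simp
  finally show ?thesis .
qed

subsection \<open>Minimizers of exponential sums\<close>

text \<open>Attainment holds for every sample, even when the objective is constant along some directions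
  \<open>L\<close>: on the orthogonal complement of \<open>L\<close> a direction that decreases one exponent increases
  another, because the \<open>c s\<close> sum to zero.\<close>

lemma exp_sum_attains_minimum:
  fixes c :: "'i \<Rightarrow> 'a::euclidean_space" and b :: "'i \<Rightarrow> real"
  assumes I: "finite I" and D: "subspace D" and c: "(\<Sum>s\<in>I. c s) = 0"
  shows "\<exists>w. w - w0 \<in> D \<and>
    (\<forall>v. v - w0 \<in> D \<longrightarrow> (\<Sum>s\<in>I. exp (w \<bullet> c s - b s)) \<le> (\<Sum>s\<in>I. exp (v \<bullet> c s - b s)))"
proof -
  define f where "f w = (\<Sum>s\<in>I. exp (w \<bullet> c s - b s))" for w
  have f_cont: "continuous_on A (\<lambda>z. f (w0 + z))" for A
    unfolding f_def by (intro continuous_intros)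
  define L where "L = {d \<in> D. \<forall>s\<in>I. d \<bullet> c s = 0}"
  have L: "subspace L" using D by (auto simp: L_def subspace_def inner_simps)
  define E where "E = D \<inter> {z. \<forall>d\<in>L. z \<bullet> d = 0}"
  have E_sub: "subspace E" using D by (auto simp: E_def subspace_def inner_simps)
  define n where "n z = (\<Sum>s\<in>I. \<bar>z \<bullet> c s\<bar>)" for z
  \<comment> \<open>\<open>n\<close> is a seminorm that vanishes on \<open>E\<close> only at 0,
    since a zero in \<open>E\<close> lies in \<open>L\<close> and is orthogonal to \<open>L\<close>.
    Its minimum over the compact unit sphere of \<open>E\<close> is thus a positive
    \<open>m\<close>; if that sphere is empty, \<open>E\<close> is trivial and any \<open>m\<close>
    will do.\<close>
  obtain m where m: "0 < m" "\<And>z. z \<in> E \<Longrightarrow> m * norm z \<le> n z"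
  proof (cases "E \<inter> sphere 0 1 = {}")
    case True
    have z0: "z = 0" if "z \<in> E" for z
    proof (rule ccontr)
      assume "z \<noteq> 0"
      then have "sgn z \<in> E \<inter> sphere 0 1"
        using that subspace_scale[OF E_sub] by (auto simp: sgn_div_norm)
      with True show False by simp
    qed
    show ?thesis by (intro that[of 1]) (auto simp: n_def dest: z0)
  next
    case False
    have "compact (E \<inter> sphere 0 1)"
      using closed_Int_compact[OF closed_subspace[OF E_sub] compact_sphere] .
    moreover have "continuous_on (E \<inter> sphere 0 1) n"
      unfolding n_def by (intro continuous_intros)
    ultimately obtain u where u: "u \<in> E \<inter> sphere 0 1" "\<And>z. z \<in> E \<inter> sphere 0 1 \<Longrightarrow> n u \<le> n z"
      using continuous_attains_inf[OF _ False] by blast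
    have "0 < n u"
    proof (rule ccontr)
      assume "\<not> 0 < n u"
      moreover have "0 \<le> n u" unfolding n_def by (intro sum_nonneg) auto
      ultimately have "n u = 0" by simp
      then have "u \<in> L" using u I by (auto simp: n_def sum_nonneg_eq_0_iff L_def E_def)
      then have "u \<bullet> u = 0" using u by (auto simp: E_def)
      with u show False by auto
    qed
    moreover have "n u * norm z \<le> n z" if "z \<in> E" for z
    proof (cases "z = 0")
      case False
      then have "sgn z \<in> E \<inter> sphere 0 1"
        using that subspace_scale[OF E_sub] by (auto simp: sgn_div_norm)
      then have "norm z * n u \<le> norm z * n (sgn z)"
        using u(2) by (intro mult_left_mono) auto
      also have "\<dots> = n z"
        using False by (simp add: n_def sum_distrib_left sgn_div_norm abs_mult mult.assoc[symmetric])
      finally show ?thesis by (simp add: mult.commute)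
    qed (simp add: n_def)
    ultimately show ?thesis by (rule that)
  qed
  define C where "C = E \<inter> {z. f (w0 + z) \<le> f w0}"
  \<comment> \<open>On \<open>C\<close> each single exponential is at most \<open>f w0\<close>;
    taking logarithms bounds \<open>z \<bullet> c s\<close> by one summand of \<kappa>. The sum
    makes the bound uniform in \<open>s\<close>.\<close>
  define \<kappa> where "\<kappa> = (\<Sum>s\<in>I. \<bar>ln (f w0) + b s - w0 \<bullet> c s\<bar>)"
  have bound: "n z \<le> 2 * (\<Sum>s\<in>I. \<kappa>)" if "z \<in> C" for z
  proof -
    have up: "z \<bullet> c s \<le> \<kappa>" if s: "s \<in> I" for s
    proof -
      have "exp ((w0 + z) \<bullet> c s - b s) \<le> f (w0 + z)"
        unfolding f_def using I s by (intro member_le_sum) auto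
      also have "\<dots> \<le> f w0" using \<open>z \<in> C\<close> by (simp add: C_def)
      finally have "(w0 + z) \<bullet> c s - b s \<le> ln (f w0)"
        by (metis exp_gt_zero ln_exp ln_le_cancel_iff order_less_le_trans)
      then have "z \<bullet> c s \<le> \<bar>ln (f w0) + b s - w0 \<bullet> c s\<bar>" by (simp add: inner_simps)
      also have "\<dots> \<le> \<kappa>" unfolding \<kappa>_def using I s by (intro member_le_sum) auto
      finally show ?thesis .
    qed
    have "0 \<le> \<kappa>" by (simp add: \<kappa>_def sum_nonneg)
    \<comment> \<open>Writing \<open>\<bar>r\<bar>\<close> as \<open>2 * max 0 r - r\<close> leaves
      a linear part that cancels because the \<open>c s\<close> sum to zero. Upper bounds on the
      exponents alone thus bound \<open>n z\<close>.\<close>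
    have "n z = (\<Sum>s\<in>I. 2 * max 0 (z \<bullet> c s) - z \<bullet> c s)"
      unfolding n_def by (intro sum.cong) auto
    also have "\<dots> = 2 * (\<Sum>s\<in>I. max 0 (z \<bullet> c s)) - z \<bullet> (\<Sum>s\<in>I. c s)"
      by (simp add: sum_subtractf sum_distrib_left inner_sum_right)
    also have "\<dots> = 2 * (\<Sum>s\<in>I. max 0 (z \<bullet> c s))" by (simp add: c)
    also have "\<dots> \<le> 2 * (\<Sum>s\<in>I. \<kappa>)"
      using up \<open>0 \<le> \<kappa>\<close> by (intro mult_left_mono sum_mono) auto
    finally show ?thesis .
  qed
  have "bounded C"
    unfolding bounded_iff
  proof (intro exI ballI)
    fix z assume "z \<in> C"
    then have "m * norm z \<le> 2 * (\<Sum>s\<in>I. \<kappa>)" using m(2)[of z] bound[of z] by (auto simp: C_def)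
    then show "norm z \<le> 2 * (\<Sum>s\<in>I. \<kappa>) / m" using m(1) by (simp add: field_simps)
  qed
  moreover have "closed C"
    unfolding C_def by (intro closed_Int closed_subspace E_sub closed_Collect_le f_cont continuous_intros)
  ultimately have compact: "compact C" by (simp add: compact_eq_bounded_closed)
  have zero: "0 \<in> C" using subspace_0[OF E_sub] by (simp add: C_def)
  then have "C \<noteq> {}" by blast
  from continuous_attains_inf[OF compact this f_cont]
  obtain z where z: "z \<in> C" "\<And>v. v \<in> C \<Longrightarrow> f (w0 + z) \<le> f (w0 + v)" by auto
  have "f (w0 + z) \<le> f v" if v: "v - w0 \<in> D" for v
  proof -
    have span: "span L = L" using L by (simp add: span_eq_iff)
    obtain y x where yx: "y \<in> L" "\<And>d. d \<in> L \<Longrightarrow> orthogonal x d" "v - w0 = y + x"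
      using orthogonal_subspace_decomp_exists[of L "v - w0"] unfolding span by metis
    have v_eq: "v = w0 + x + y" using yx(3) by (simp add: algebra_simps)
    have "y \<in> D" using yx(1) by (simp add: L_def)
    then have "x \<in> D" using subspace_diff[OF D v] yx(3) by fastforce
    then have "x \<in> E" using yx(2) by (auto simp: E_def orthogonal_def)
    have "f v = f (w0 + x)"
      using yx(1) by (simp add: f_def v_eq L_def inner_simps)
    \<comment> \<open>Outside \<open>C\<close> the value exceeds \<open>f w0\<close>, which is
      itself no smaller than the minimum because 0 lies in \<open>C\<close>.\<close>
    moreover have "f (w0 + z) \<le> f (w0 + x)"
      using z(2)[of x] z(2)[OF zero] \<open>x \<in> E\<close> by (cases "x \<in> C") (auto simp: C_def)
    ultimately show ?thesis by simp
  qed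
  moreover have "z \<in> D" using z(1) by (simp add: C_def E_def)
  ultimately show ?thesis by (intro exI[of _ "w0 + z"]) (auto simp: f_def)
qed

subsection \<open>Empirical risk under exponential tilting\<close>

locale exponential_tilting = prob_space P for P :: "'x measure" +
  fixes l :: "'x \<Rightarrow> 'a::euclidean_space" and b :: "'x \<Rightarrow> real"
  assumes l_integrable: "integrable P l" and b_measurable[measurable]: "b \<in> borel_measurable P"
begin

lemma l_measurable[measurable]: "l \<in> borel_measurable P"
  using l_integrable by auto

definition \<mu> :: 'a where "\<mu> = integral\<^sup>L P l"

definition k :: "'a \<Rightarrow> 'x \<Rightarrow> real" where "k w x = exp (w \<bullet> l x - b x)"

lemma k_measurable[measurable]: "k w \<in> borel_measurable P"
  unfolding k_def by measurable

text \<open>The integral has the default value 0 when \<open>k w\<close> is not integrable, so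
  bounds on \<open>risk\<close> are paired with integrability of \<open>k w\<close>.\<close>

definition risk :: "'a \<Rightarrow> real" where "risk w = exp (- (w \<bullet> \<mu>)) * integral\<^sup>L P (k w)"

definition emp_mean :: "nat \<Rightarrow> (nat \<Rightarrow> 'x) \<Rightarrow> 'a" where
  "emp_mean S xs = (\<Sum>s<S. l (xs s)) /\<^sub>R real S"

text \<open>Centring is at the empirical mean and not at \<mu>: this matches the Monte Carlo
  objective and makes the centred exponents sum to zero over the sample.\<close>

definition emp_risk :: "nat \<Rightarrow> (nat \<Rightarrow> 'x) \<Rightarrow> 'a \<Rightarrow> real" where
  "emp_risk S xs w = exp (- (w \<bullet> emp_mean S xs)) * ((\<Sum>s<S. k w (xs s)) / real S)"

text \<open>The cut-off is on \<open>l\<close> and \<open>b\<close>, not on the size of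
  \<open>k w\<close>, so the region does not depend on \<open>w\<close>. On it the exponent is
  bounded and is Lipschitz in \<open>w\<close> with constant \<open>R\<close>.\<close>

definition trunc_k :: "nat \<Rightarrow> 'a \<Rightarrow> 'x \<Rightarrow> real" where
  "trunc_k R w x = (if norm (l x) \<le> real R \<and> \<bar>b x\<bar> \<le> real R then k w x else 0)"

lemma trunc_k_measurable[measurable]: "trunc_k R w \<in> borel_measurable P"
  unfolding trunc_k_def by measurable

lemma trunc_k_le_k: "trunc_k R w x \<le> k w x"
  by (auto simp: trunc_k_def k_def)

lemma trunc_k_integrable: "integrable P (trunc_k R w)"
proof (rule integrable_const_bound)
  show "AE x in P. norm (trunc_k R w x) \<le> exp (norm w * real R + real R)"
  proof (intro AE_I2)
    fix x
    show "norm (trunc_k R w x) \<le> exp (norm w * real R + real R)"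
    proof (cases "norm (l x) \<le> real R \<and> \<bar>b x\<bar> \<le> real R")
      case True
      then have "w \<bullet> l x \<le> norm w * real R"
        by (meson norm_cauchy_schwarz mult_left_mono norm_ge_zero order_trans)
      with True show ?thesis by (auto simp: trunc_k_def k_def)
    qed (auto simp: trunc_k_def)
  qed
qed measurable

lemma trunc_k_lipschitz: "exp (- (norm (w - q) * real R)) * trunc_k R q x \<le> trunc_k R w x"
proof (cases "norm (l x) \<le> real R \<and> \<bar>b x\<bar> \<le> real R")
  case True
  have "(q - w) \<bullet> l x \<le> norm (q - w) * norm (l x)"
    by (rule norm_cauchy_schwarz)
  also have "\<dots> \<le> norm (w - q) * real R"
    using True by (intro mult_mono) (auto simp: norm_minus_commute)
  finally have "q \<bullet> l x - norm (w - q) * real R \<le> w \<bullet> l x"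
    by (simp add: inner_diff_left)
  with True show ?thesis by (auto simp: trunc_k_def k_def exp_add[symmetric])
qed (auto simp: trunc_k_def)

lemma integral_trunc_k_lipschitz:
  "exp (- (norm (w - q) * real R)) * integral\<^sup>L P (trunc_k R q) \<le> integral\<^sup>L P (trunc_k R w)"
proof -
  have "integral\<^sup>L P (\<lambda>x. exp (- (norm (w - q) * real R)) * trunc_k R q x) \<le> integral\<^sup>L P (trunc_k R w)"
    by (intro integral_mono trunc_k_lipschitz integrable_mult_right trunc_k_integrable)
  then show ?thesis by simp
qed

text \<open>Monotone convergence: the truncations increase to \<open>k w\<close>, so a uniform bound
  on their integrals yields integrability together with the bound.\<close>

lemma integral_k_le_of_trunc:
  assumes "\<And>R. integral\<^sup>L P (trunc_k R w) \<le> B"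
  shows "integrable P (k w)" "integral\<^sup>L P (k w) \<le> B"
proof -
  have mono: "trunc_k R w x \<le> trunc_k R' w x" if "R \<le> R'" for R R' x
    using that by (auto simp: trunc_k_def k_def)
  have "incseq (\<lambda>R. integral\<^sup>L P (trunc_k R w))"
    by (intro monoI integral_mono mono trunc_k_integrable)
  then obtain I where I: "(\<lambda>R. integral\<^sup>L P (trunc_k R w)) \<longlonglongrightarrow> I"
    using incseq_convergent[of "\<lambda>R. integral\<^sup>L P (trunc_k R w)" B] assms by blast
  have lim: "(\<lambda>R. trunc_k R w x) \<longlonglongrightarrow> k w x" for x
  proof -
    obtain R0 :: nat where "norm (l x) + \<bar>b x\<bar> \<le> real R0" using real_arch_simple by blast
    then have "trunc_k R w x = k w x" if "R0 \<le> R" for R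
    proof -
      have "real R0 \<le> real R" using that by simp
      with \<open>norm (l x) + \<bar>b x\<bar> \<le> real R0\<close> have "norm (l x) \<le> real R \<and> \<bar>b x\<bar> \<le> real R"
        using norm_ge_zero[of "l x"] abs_ge_zero[of "b x"] by linarith
      then show ?thesis by (simp add: trunc_k_def)
    qed
    then show ?thesis
      by (intro tendsto_eventually) (auto simp: eventually_sequentially)
  qed
  have m: "AE x in P. mono (\<lambda>R. trunc_k R w x)" and l: "AE x in P. (\<lambda>R. trunc_k R w x) \<longlonglongrightarrow> k w x"
    using mono lim by (auto intro!: AE_I2 monoI)
  show "integrable P (k w)"
    by (rule integrable_monotone_convergence[OF trunc_k_integrable m l I]) simp
  have "integral\<^sup>L P (k w) = I"
    by (rule integral_monotone_convergence[OF trunc_k_integrable m l I]) simp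
  also have "I \<le> B"
    using I assms by (intro LIMSEQ_le_const2) auto
  finally show "integral\<^sup>L P (k w) \<le> B" .
qed

text \<open>The samples enter only through these limits, which the strong law provides almost surely.\<close>

definition typical :: "'a set \<Rightarrow> (nat \<Rightarrow> 'x) \<Rightarrow> bool" where
  "typical Q xs \<longleftrightarrow> (\<lambda>S. emp_mean S xs) \<longlonglongrightarrow> \<mu> \<and>
     (\<forall>R. \<forall>q\<in>Q. (\<lambda>S. (\<Sum>s<S. trunc_k R q (xs s)) / real S) \<longlonglongrightarrow> integral\<^sup>L P (trunc_k R q))"

text \<open>Lower semicontinuity along the samples.  The truncated \<open>k\<close> is uniformly log-Lipschitz in \<open>w\<close>,
  so its averages converge locally uniformly; no integrability of \<open>k w\<close> at the limit point is assumed.\<close>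

lemma emp_risk_liminf:
  assumes typical: "typical Q xs" and dense: "\<And>w e. 0 < e \<Longrightarrow> \<exists>q\<in>Q. norm (w - q) < e"
    and r: "filterlim r at_top sequentially" and v: "v \<longlonglongrightarrow> w"
    and le: "eventually (\<lambda>j. emp_risk (r j) xs (v j) \<le> A j) sequentially" and A: "A \<longlonglongrightarrow> a"
  shows "integrable P (k w)" "risk w \<le> a"
proof -
  let ?B = "a * exp (w \<bullet> \<mu>)"
  have mean: "(\<lambda>j. emp_mean (r j) xs) \<longlonglongrightarrow> \<mu>"
    using typical r by (auto simp: typical_def intro: filterlim_compose)
  \<comment> \<open>Convergence of the truncated averages is known only at points of
    \<open>Q\<close>, so \<open>v j\<close> is compared with a fixed \<open>q\<close> at the price
    of a Lipschitz factor.\<close>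
  have near: "exp (- (norm (w - q) * real R)) * integral\<^sup>L P (trunc_k R q) \<le> ?B" if "q \<in> Q" for R q
  proof (rule tendsto_le[OF sequentially_bot])
    show "(\<lambda>j. exp (- (norm (v j - q) * real R)) * ((\<Sum>s<r j. trunc_k R q (xs s)) / real (r j)))
        \<longlonglongrightarrow> exp (- (norm (w - q) * real R)) * integral\<^sup>L P (trunc_k R q)"
      using typical that r v
      by (intro tendsto_intros filterlim_compose[OF _ r, of "\<lambda>S. (\<Sum>s<S. trunc_k R q (xs s)) / real S"])
        (auto simp: typical_def)
    show "(\<lambda>j. A j * exp (v j \<bullet> emp_mean (r j) xs)) \<longlonglongrightarrow> ?B"
      using A v mean by (intro tendsto_intros)
    show "eventually (\<lambda>j. exp (- (norm (v j - q) * real R)) * ((\<Sum>s<r j. trunc_k R q (xs s)) / real (r j))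
        \<le> A j * exp (v j \<bullet> emp_mean (r j) xs)) sequentially"
      using le
    proof eventually_elim
      case (elim j)
      have "exp (- (norm (v j - q) * real R)) * ((\<Sum>s<r j. trunc_k R q (xs s)) / real (r j)) =
          (\<Sum>s<r j. exp (- (norm (v j - q) * real R)) * trunc_k R q (xs s)) / real (r j)"
        by (simp add: sum_distrib_left)
      also have "\<dots> \<le> (\<Sum>s<r j. k (v j) (xs s)) / real (r j)"
        by (intro divide_right_mono sum_mono order_trans[OF trunc_k_lipschitz trunc_k_le_k]) auto
      also have "\<dots> = emp_risk (r j) xs (v j) * exp (v j \<bullet> emp_mean (r j) xs)"
        by (simp add: emp_risk_def exp_minus field_simps)
      also have "\<dots> \<le> A j * exp (v j \<bullet> emp_mean (r j) xs)"
        using elim by (intro mult_right_mono) auto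
      finally show ?case .
    qed
  qed
  \<comment> \<open>Letting \<open>q\<close> approach \<open>w\<close> removes the loss. The factor
    occurs twice: once from \<open>near\<close>, once from replacing the integral at
    \<open>q\<close> by the one at \<open>w\<close>.\<close>
  have trunc: "integral\<^sup>L P (trunc_k R w) \<le> ?B" for R
  proof -
    have "\<forall>n. \<exists>q\<in>Q. norm (w - q) < inverse (real (Suc n))"
      by (intro allI dense) simp
    then obtain q where q: "\<And>n. q n \<in> Q" "\<And>n. norm (w - q n) < inverse (real (Suc n))"
      by metis
    have "(\<lambda>n. w - q n) \<longlonglongrightarrow> 0"
      by (rule Lim_null_comparison[OF _ LIMSEQ_inverse_real_of_nat]) (use q(2) in \<open>auto intro!: always_eventually less_imp_le\<close>)
    then have "(\<lambda>n. norm (w - q n)) \<longlonglongrightarrow> 0"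
      by (simp add: tendsto_norm_zero)
    then have "(\<lambda>n. exp (- (norm (w - q n) * real R)) * (exp (- (norm (w - q n) * real R)) * integral\<^sup>L P (trunc_k R w)))
       \<longlonglongrightarrow> exp (- (0 * real R)) * (exp (- (0 * real R)) * integral\<^sup>L P (trunc_k R w))"
      by (intro tendsto_intros)
    moreover have "exp (- (norm (w - q n) * real R)) * (exp (- (norm (w - q n) * real R)) * integral\<^sup>L P (trunc_k R w)) \<le> ?B" for n
    proof -
      have "exp (- (norm (w - q n) * real R)) * (exp (- (norm (w - q n) * real R)) * integral\<^sup>L P (trunc_k R w))
         \<le> exp (- (norm (w - q n) * real R)) * integral\<^sup>L P (trunc_k R (q n))"
        using integral_trunc_k_lipschitz[of "q n" w R] by (intro mult_left_mono) (auto simp: norm_minus_commute)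
      also have "\<dots> \<le> ?B" by (rule near[OF q(1)])
      finally show ?thesis .
    qed
    ultimately show ?thesis
      using LIMSEQ_le_const2[of _ "integral\<^sup>L P (trunc_k R w)" ?B] by auto
  qed
  show "integrable P (k w)" by (rule integral_k_le_of_trunc[OF trunc])
  have "risk w \<le> exp (- (w \<bullet> \<mu>)) * ?B"
    unfolding risk_def using integral_k_le_of_trunc(2)[OF trunc] by (intro mult_left_mono) auto
  then show "risk w \<le> a" by (simp add: exp_minus field_simps)
qed

text \<open>With \<open>Y = u \<bullet> l - u \<bullet> \<mu>\<close>, the inequality
  \<open>t * max 0 Y \<le> exp (t * Y)\<close> bounds \<open>t\<close> times the weighted integral
  of the positive part of \<open>Y\<close> by \<open>a\<close> for all \<open>t \<ge> 0\<close>. So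
  \<open>Y \<le> 0\<close> almost surely, and since \<open>Y\<close> has mean zero it
  vanishes.\<close>

lemma flat_direction:
  assumes "\<And>t. 0 \<le> t \<Longrightarrow> integrable P (k (w + t *\<^sub>R u))" "\<And>t. 0 \<le> t \<Longrightarrow> risk (w + t *\<^sub>R u) \<le> a"
  shows "AE x in P. u \<bullet> l x = u \<bullet> \<mu>"
proof -
  define Q where "Q x = exp (- (w \<bullet> \<mu>)) * k w x" for x
  define Y where "Y x = u \<bullet> l x - u \<bullet> \<mu>" for x
  have [measurable]: "Q \<in> borel_measurable P" "Y \<in> borel_measurable P"
    unfolding Q_def Y_def by measurable
  have Qpos: "0 < Q x" for x by (simp add: Q_def k_def)
  have eq: "Q x * exp (t * Y x) = exp (- ((w + t *\<^sub>R u) \<bullet> \<mu>)) * k (w + t *\<^sub>R u) x" for t x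
    by (simp add: Q_def Y_def k_def exp_add[symmetric] inner_simps algebra_simps)
  have int: "integrable P (\<lambda>x. Q x * exp (t * Y x))" and le: "(\<integral>x. Q x * exp (t * Y x) \<partial>P) \<le> a" if "0 \<le> t" for t
    using assms[OF that] by (simp_all add: eq risk_def)
  have pw: "t * (Q x * max 0 (Y x)) \<le> Q x * exp (t * Y x)" if "0 \<le> t" for t x
  proof -
    have "t * max 0 (Y x) \<le> exp (t * Y x)"
    proof -
      have "t * Y x \<le> exp (t * Y x)" using exp_ge_add_one_self[of "t * Y x"] by linarith
      then show ?thesis by (simp add: max_def)
    qed
    then have "Q x * (t * max 0 (Y x)) \<le> Q x * exp (t * Y x)"
      using Qpos[of x] by (intro mult_left_mono) auto
    then show ?thesis by (simp add: algebra_simps)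
  qed
  have i0: "integrable P (\<lambda>x. Q x * max 0 (Y x))"
    by (rule Bochner_Integration.integrable_bound[OF int[of 1]])
      (use pw[of 1] Qpos in \<open>auto intro!: AE_I2 simp: less_imp_le\<close>)
  let ?I = "\<integral>x. Q x * max 0 (Y x) \<partial>P"
  have "real n * ?I \<le> a" for n :: nat
  proof -
    have "real n * ?I = (\<integral>x. real n * (Q x * max 0 (Y x)) \<partial>P)" by simp
    also have "\<dots> \<le> (\<integral>x. Q x * exp (real n * Y x) \<partial>P)"
      using int pw by (intro integral_mono integrable_mult_right i0) auto
    also have "\<dots> \<le> a" by (rule le) simp
    finally show ?thesis .
  qed
  moreover have "0 \<le> ?I" using Qpos by (intro integral_nonneg_AE AE_I2) (simp add: less_imp_le)
  ultimately have "?I = 0"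
    using reals_Archimedean3[of ?I] by (metis less_le not_le)
  then have "AE x in P. Q x * max 0 (Y x) = 0"
    using i0 Qpos by (subst (asm) integral_nonneg_eq_0_iff_AE) (auto simp: less_imp_le)
  then have Y: "AE x in P. 0 \<le> - Y x"
  proof eventually_elim
    case (elim x)
    then show ?case using Qpos[of x] by (auto simp: max_def split: if_splits)
  qed
  have iY: "integrable P Y" unfolding Y_def using l_integrable by auto
  have "(\<integral>x. - Y x \<partial>P) = 0"
    unfolding Y_def \<mu>_def using l_integrable by (simp add: prob_space)
  then have "AE x in P. - Y x = 0"
    using iY Y by (subst (asm) integral_nonneg_eq_0_iff_AE) auto
  then show ?thesis by eventually_elim (simp add: Y_def)
qed

section \<open>Convexity of the empirical risk and almost sure limits\<close>

lemma emp_risk_altdef: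
  "emp_risk S xs w = (\<Sum>s<S. exp (w \<bullet> (l (xs s) - emp_mean S xs) - b (xs s))) / real S"
  by (simp add: emp_risk_def k_def sum_distrib_left exp_add[symmetric] inner_diff_right algebra_simps)

text \<open>Convexity of \<open>exp\<close>, stated for sublevel sets; it pulls points far from
  \<open>w0\<close> back to bounded distance.\<close>

lemma emp_risk_segment:
  assumes "emp_risk S xs w \<le> c" "emp_risk S xs v \<le> c" "0 \<le> t" "t \<le> 1"
  shows "emp_risk S xs ((1 - t) *\<^sub>R w + t *\<^sub>R v) \<le> c"
proof -
  let ?y = "\<lambda>s w. w \<bullet> (l (xs s) - emp_mean S xs) - b (xs s)"
  have "emp_risk S xs ((1 - t) *\<^sub>R w + t *\<^sub>R v) = (\<Sum>s<S. exp ((1 - t) *\<^sub>R ?y s w + t *\<^sub>R ?y s v)) / real S"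
    unfolding emp_risk_altdef by (simp add: inner_add_left algebra_simps)
  also have "\<dots> \<le> (\<Sum>s<S. (1 - t) * exp (?y s w) + t * exp (?y s v)) / real S"
    using assms by (intro divide_right_mono sum_mono convex_onD[OF exp_convex]) auto
  also have "\<dots> = (1 - t) * emp_risk S xs w + t * emp_risk S xs v"
    unfolding emp_risk_altdef by (simp add: sum.distrib sum_distrib_left add_divide_distrib)
  also have "\<dots> \<le> (1 - t) * c + t * c"
    using assms by (intro add_mono mult_left_mono) auto
  finally show ?thesis by (simp add: algebra_simps)
qed

lemma emp_mean_tendsto:
  assumes "prob_space M" "prob_space.indep_vars M (\<lambda>_. LX) X UNIV" "\<And>s. distr M LX (X s) = P"
  shows "AE \<omega> in M. (\<lambda>S. emp_mean S (\<lambda>s. X s \<omega>)) \<longlonglongrightarrow> \<mu>"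
proof -
  have "AE \<omega> in M. \<forall>i\<in>Basis. (\<lambda>S. (\<Sum>s<S. l (X s \<omega>) \<bullet> i) / real S) \<longlonglongrightarrow> (\<integral>x. l x \<bullet> i \<partial>P)"
    by (intro AE_finite_allI finite_Basis prob_space.strong_law_sample[OF assms] integrable_inner_left impI l_integrable)
  then show ?thesis
  proof eventually_elim
    case (elim \<omega>)
    have "emp_mean S (\<lambda>s. X s \<omega>) \<bullet> i = (\<Sum>s<S. l (X s \<omega>) \<bullet> i) / real S" for S i
      by (simp add: emp_mean_def inner_sum_left field_simps)
    with elim show ?case
      by (subst tendsto_componentwise_iff) (simp add: \<mu>_def l_integrable)
  qed
qed

lemma emp_risk_tendsto:
  assumes "prob_space M" "prob_space.indep_vars M (\<lambda>_. LX) X UNIV" "\<And>s. distr M LX (X s) = P"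
    and "integrable P (k w)"
  shows "AE \<omega> in M. (\<lambda>S. emp_risk S (\<lambda>s. X s \<omega>) w) \<longlonglongrightarrow> risk w"
  using emp_mean_tendsto[OF assms(1-3)] prob_space.strong_law_sample[OF assms]
  unfolding emp_risk_def risk_def by eventually_elim (intro tendsto_intros)

text \<open>Countably many strong laws, one for each \<open>R\<close> and each \<open>q\<close> in
  \<open>Q\<close>, share one null set.\<close>

lemma AE_typical:
  assumes "prob_space M" "prob_space.indep_vars M (\<lambda>_. LX) X UNIV" "\<And>s. distr M LX (X s) = P"
    and "countable Q"
  shows "AE \<omega> in M. typical Q (\<lambda>s. X s \<omega>)"
proof -
  have "AE \<omega> in M. \<forall>R. \<forall>q\<in>Q. (\<lambda>S. (\<Sum>s<S. trunc_k R q (X s \<omega>)) / real S) \<longlonglongrightarrow> integral\<^sup>L P (trunc_k R q)"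
    unfolding AE_all_countable AE_ball_countable[OF \<open>countable Q\<close>]
    by (intro allI ballI prob_space.strong_law_sample[OF assms(1-3)] trunc_k_integrable)
  with emp_mean_tendsto[OF assms(1-3)] show ?thesis
    unfolding typical_def by eventually_elim simp
qed

section \<open>Flat directions and consistency of the empirical minimizers\<close>

definition flat :: "'a set \<Rightarrow> 'a set" where
  "flat D = {d \<in> D. AE x in P. d \<bullet> l x = d \<bullet> \<mu>}"

lemma subspace_flat: "subspace D \<Longrightarrow> subspace (flat D)"
  unfolding subspace_def flat_def
  by (auto simp: inner_simps elim: AE_mp)

text \<open>There may be uncountably many flat directions, but the equation is linear in
  \<open>d\<close>, so a finite basis suffices and leaves countably many null sets.\<close>

lemma AE_flat_samples:
  fixes X :: "nat \<Rightarrow> 'o \<Rightarrow> 'x"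
  assumes "prob_space M" "prob_space.indep_vars M (\<lambda>_. LX) X UNIV" "\<And>s. distr M LX (X s) = P"
  shows "AE \<omega> in M. \<forall>d\<in>flat D. \<forall>s. d \<bullet> l (X s \<omega>) = d \<bullet> \<mu>"
proof -
  have X[measurable]: "X s \<in> measurable M LX" for s
    using assms by (auto simp: prob_space.indep_vars_def)
  obtain B where B: "B \<subseteq> flat D" "finite B" "flat D \<subseteq> span B"
    using basis_exists[of "flat D"] finiteI_independent by metis
  have ae: "AE \<omega> in M. d \<bullet> l (X s \<omega>) = d \<bullet> \<mu>" if "d \<in> B" for d s
  proof -
    have "AE x in distr M LX (X s). d \<bullet> l x = d \<bullet> \<mu>"
      unfolding assms(3) using that B(1) by (auto simp: flat_def)
    then show ?thesis by (rule AE_distrD[OF X])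
  qed
  have "AE \<omega> in M. \<forall>s. d \<bullet> l (X s \<omega>) = d \<bullet> \<mu>" if "d \<in> B" for d
    unfolding AE_all_countable by (intro allI ae[OF that])
  then have "AE \<omega> in M. \<forall>d\<in>B. \<forall>s. d \<bullet> l (X s \<omega>) = d \<bullet> \<mu>"
    by (intro AE_finite_allI[OF \<open>finite B\<close>])
  then show ?thesis
  proof eventually_elim
    case (elim \<omega>)
    have "span B \<subseteq> {d. \<forall>s. d \<bullet> l (X s \<omega>) = d \<bullet> \<mu>}"
      using elim by (intro span_minimal) (auto simp: subspace_def inner_simps)
    with B(3) show ?case by auto
  qed
qed

lemma emp_risk_flat:
  assumes "0 < S" "\<And>s. y \<bullet> l (xs s) = y \<bullet> \<mu>"
  shows "emp_risk S xs (w + y) = emp_risk S xs w"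
proof -
  have "y \<bullet> emp_mean S xs = y \<bullet> \<mu>"
    using assms by (simp add: emp_mean_def inner_sum_right)
  then show ?thesis
    using assms by (simp add: emp_risk_altdef inner_simps)
qed

text \<open>Moving by \<open>y\<close> multiplies \<open>k w\<close> by the constant
  \<open>exp (y \<bullet> \<mu>)\<close>, which the centring factor of \<open>risk\<close>
  cancels.\<close>

lemma risk_flat:
  assumes "AE x in P. y \<bullet> l x = y \<bullet> \<mu>" "integrable P (k w)"
  shows "integrable P (k (w + y))" "risk (w + y) = risk w"
proof -
  have ae: "AE x in P. k (w + y) x = exp (y \<bullet> \<mu>) * k w x"
    using assms(1) by eventually_elim (simp add: k_def inner_simps exp_add[symmetric] algebra_simps)
  show "integrable P (k (w + y))"
    using assms(2) by (subst integrable_cong_AE[OF _ _ ae]) auto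
  have "integral\<^sup>L P (k (w + y)) = exp (y \<bullet> \<mu>) * integral\<^sup>L P (k w)"
    by (subst integral_cong_AE[OF _ _ ae]) auto
  then show "risk (w + y) = risk w"
    by (simp add: risk_def exp_add exp_diff exp_minus inner_simps field_simps)
qed

text \<open>Minimality of \<open>W S\<close> enters only through the comparison with
  \<open>w0\<close>. In a counterexample subsequence the part of \<open>W S - w0\<close> orthogonal
  to the flat directions either has a bounded subsequence, whose limit leads to points of
  \<open>K\<close>, or escapes in a direction that turns out to be flat.\<close>

lemma emp_risk_minimizers_tendsto:
  assumes typical: "typical Q xs" and dense: "\<And>w e. 0 < e \<Longrightarrow> \<exists>q\<in>Q. norm (w - q) < e"
    and conv: "(\<lambda>S. emp_risk S xs w0) \<longlonglongrightarrow> risk w0"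
    and D: "subspace D" and flat: "\<And>d s. d \<in> flat D \<Longrightarrow> d \<bullet> l (xs s) = d \<bullet> \<mu>"
    and W: "\<And>S. 0 < S \<Longrightarrow> W S - w0 \<in> D" "\<And>S. 0 < S \<Longrightarrow> emp_risk S xs (W S) \<le> emp_risk S xs w0"
  defines "K \<equiv> {w. w - w0 \<in> D \<and> integrable P (k w) \<and> risk w \<le> risk w0}"
  shows "(\<lambda>S. infdist (W S) K) \<longlonglongrightarrow> 0"
proof (rule ccontr)
  assume "\<not> ?thesis"
  then obtain e where e: "0 < e" "\<not> eventually (\<lambda>S. infdist (W S) K < e) sequentially"
    by (auto simp: tendsto_iff infdist_nonneg)
  \<comment> \<open>The index 0 is left out because nothing is assumed about
    \<open>W 0\<close>.\<close>
  define r where "r = enumerate {S. 0 < S \<and> e \<le> infdist (W S) K}"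
  have inf: "infinite {S. 0 < S \<and> e \<le> infdist (W S) K}"
  proof
    assume "finite {S. 0 < S \<and> e \<le> infdist (W S) K}"
    then obtain m where m: "\<And>S. 0 < S \<Longrightarrow> e \<le> infdist (W S) K \<Longrightarrow> S \<le> m"
      by (auto simp: finite_nat_set_iff_bounded_le)
    have "eventually (\<lambda>S. infdist (W S) K < e) sequentially"
      using eventually_gt_at_top[of m]
    proof eventually_elim
      case (elim S)
      then show ?case using m[of S] by (cases "e \<le> infdist (W S) K") auto
    qed
    with e show False by simp
  qed
  have r: "strict_mono r" and r_pos: "0 < r j" and r_dist: "e \<le> infdist (W (r j)) K" for j
    using enumerate_in_set[OF inf] strict_mono_enumerate[OF inf] by (auto simp: r_def)
  have "\<exists>y z. y \<in> flat D \<and> z \<in> D \<and> (\<forall>d\<in>flat D. z \<bullet> d = 0) \<and> W S = w0 + z + y" if "0 < S" for S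
  proof -
    have span: "span (flat D) = flat D" using subspace_flat[OF D] by (simp add: span_eq_iff)
    obtain y z where yz: "y \<in> flat D" "\<And>d. d \<in> flat D \<Longrightarrow> orthogonal z d" "W S - w0 = y + z"
      using orthogonal_subspace_decomp_exists[of "flat D" "W S - w0"] unfolding span by metis
    have "z = (W S - w0) - y" using yz(3) by simp
    moreover have "y \<in> D" using yz(1) by (simp add: flat_def)
    ultimately have "z \<in> D" using W(1)[OF that] subspace_diff[OF D] by simp
    moreover have "W S = w0 + z + y" using yz(3) by (simp add: algebra_simps)
    ultimately show ?thesis using yz by (auto simp: orthogonal_def)
  qed
  then obtain y z where y: "\<And>S. 0 < S \<Longrightarrow> y S \<in> flat D" and zD: "\<And>S. 0 < S \<Longrightarrow> z S \<in> D"
    and z_orth: "\<And>S d. 0 < S \<Longrightarrow> d \<in> flat D \<Longrightarrow> z S \<bullet> d = 0"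
    and W_eq: "\<And>S. 0 < S \<Longrightarrow> W S = w0 + z S + y S"
    by metis
  have le: "emp_risk S xs (w0 + z S) \<le> emp_risk S xs w0" if "0 < S" for S
    using W(2)[OF that] emp_risk_flat[OF that flat[OF y[OF that]], where w="w0 + z S"] by (simp add: W_eq[OF that])
  have lim: "integrable P (k w)" "risk w \<le> risk w0"
    if "strict_mono \<rho>" "v \<longlonglongrightarrow> w" "eventually (\<lambda>j. emp_risk (\<rho> j) xs (v j) \<le> emp_risk (\<rho> j) xs w0) sequentially"
    for \<rho> v w
    using emp_risk_liminf[OF typical dense filterlim_subseq[OF that(1)] that(2,3)]
      filterlim_compose[OF conv filterlim_subseq[OF that(1)]] by auto
  show False
  proof (cases "\<exists>B. \<exists>\<^sub>F j in sequentially. norm (z (r j)) \<le> B")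
    case True
    then obtain B where B: "infinite {j. norm (z (r j)) \<le> B}"
      by (auto simp: frequently_cofinite[symmetric] cofinite_eq_sequentially)
    define r2 where "r2 = enumerate {j. norm (z (r j)) \<le> B}"
    have r2: "strict_mono r2" "\<And>j. z (r (r2 j)) \<in> cball 0 B"
      using enumerate_in_set[OF B] strict_mono_enumerate[OF B] by (auto simp: r2_def)
    obtain \<zeta> r3 where r3: "strict_mono r3" "((\<lambda>j. z (r (r2 j))) \<circ> r3) \<longlonglongrightarrow> \<zeta>"
      using compact_cball[of "0::'a" B] r2(2) unfolding compact_def by metis
    define \<rho> where "\<rho> = r \<circ> r2 \<circ> r3"
    have \<rho>: "strict_mono \<rho>" "(\<lambda>j. z (\<rho> j)) \<longlonglongrightarrow> \<zeta>" "\<And>j. 0 < \<rho> j" "\<And>j. e \<le> infdist (W (\<rho> j)) K"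
      using r r2(1) r3 r_pos r_dist by (auto simp: \<rho>_def comp_def strict_mono_o intro!: strict_monoI dest: strict_monoD)
    have "\<zeta> \<in> D"
      using closed_sequentially[OF closed_subspace[OF D], of "\<lambda>j. z (\<rho> j)"] zD \<rho> by auto
    have v: "(\<lambda>j. w0 + z (\<rho> j)) \<longlonglongrightarrow> w0 + \<zeta>" using \<rho>(2) by (intro tendsto_intros)
    have \<zeta>: "integrable P (k (w0 + \<zeta>))" "risk (w0 + \<zeta>) \<le> risk w0"
      using lim[OF \<rho>(1) v] le \<rho>(3) by (auto intro: always_eventually)
    \<comment> \<open>The flat components \<open>y (\<rho> j)\<close> need not converge, so the
      comparison point in \<open>K\<close> moves with them.\<close>
    have "infdist (W (\<rho> j)) K \<le> norm (z (\<rho> j) - \<zeta>)" for j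
    proof -
      have yj: "y (\<rho> j) \<in> D" "AE x in P. y (\<rho> j) \<bullet> l x = y (\<rho> j) \<bullet> \<mu>"
        using y[OF \<rho>(3)[of j]] by (auto simp: flat_def)
      have "w0 + \<zeta> + y (\<rho> j) \<in> K"
        using risk_flat[OF yj(2) \<zeta>(1)] \<zeta>(2) subspace_add[OF D \<open>\<zeta> \<in> D\<close> yj(1)] by (simp add: K_def add.assoc)
      then have "infdist (W (\<rho> j)) K \<le> dist (W (\<rho> j)) (w0 + \<zeta> + y (\<rho> j))"
        by (rule infdist_le)
      then show ?thesis by (simp add: W_eq[OF \<rho>(3)] dist_norm)
    qed
    then have "e \<le> norm (z (\<rho> j) - \<zeta>)" for j using \<rho>(4) order_trans by blast
    moreover have "(\<lambda>j. norm (z (\<rho> j) - \<zeta>)) \<longlonglongrightarrow> 0"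
      using \<rho>(2) by (simp add: LIM_zero tendsto_norm_zero)
    ultimately have "e \<le> 0" by (intro LIMSEQ_le_const) auto
    with e show False by simp
  next
    case False
    then have big: "eventually (\<lambda>j. B < norm (z (r j))) sequentially" for B
      by (auto simp: not_frequently not_le)
    have "\<And>j. sgn (z (r j)) \<in> cball 0 1" by (simp add: norm_sgn)
    then obtain u r3 where r3: "strict_mono r3" "((\<lambda>j. sgn (z (r j))) \<circ> r3) \<longlonglongrightarrow> u"
      using compact_cball[of "0::'a" 1] unfolding compact_def by metis
    define \<rho> where "\<rho> = r \<circ> r3"
    have \<rho>: "strict_mono \<rho>" "(\<lambda>j. sgn (z (\<rho> j))) \<longlonglongrightarrow> u" "\<And>j. 0 < \<rho> j"
      using r r3 r_pos by (auto simp: \<rho>_def comp_def strict_mono_o intro!: strict_monoI dest: strict_monoD)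
    have big\<rho>: "eventually (\<lambda>j. B < norm (z (\<rho> j))) sequentially" for B
      using eventually_compose_filterlim[OF big filterlim_subseq[OF r3(1)]] by (simp add: \<rho>_def)
    have "u \<in> D"
      using closed_sequentially[OF closed_subspace[OF D], of "\<lambda>j. sgn (z (\<rho> j))"] zD \<rho>
      by (auto simp: sgn_div_norm intro: subspace_scale[OF D])
    have u_orth: "u \<bullet> d = 0" if "d \<in> flat D" for d
    proof (rule LIMSEQ_unique)
      show "(\<lambda>j. sgn (z (\<rho> j)) \<bullet> d) \<longlonglongrightarrow> u \<bullet> d" using \<rho>(2) by (intro tendsto_intros)
      show "(\<lambda>j. sgn (z (\<rho> j)) \<bullet> d) \<longlonglongrightarrow> 0" using z_orth[OF \<rho>(3) that] by (simp add: sgn_div_norm)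
    qed
    have "norm u = 1"
    proof (rule LIMSEQ_unique)
      show "(\<lambda>j. norm (sgn (z (\<rho> j)))) \<longlonglongrightarrow> norm u" using \<rho>(2) by (rule tendsto_norm)
      show "(\<lambda>j. norm (sgn (z (\<rho> j)))) \<longlonglongrightarrow> 1"
        using big\<rho>[of 0] by (intro tendsto_eventually) (auto simp: norm_sgn elim: eventually_mono)
    qed
    have "integrable P (k (w0 + t *\<^sub>R u)) \<and> risk (w0 + t *\<^sub>R u) \<le> risk w0" if t: "0 \<le> t" for t
    proof -
      let ?v = "\<lambda>j. w0 + t *\<^sub>R sgn (z (\<rho> j))"
      have v: "?v \<longlonglongrightarrow> w0 + t *\<^sub>R u" using \<rho>(2) by (intro tendsto_intros)
      have "eventually (\<lambda>j. emp_risk (\<rho> j) xs (?v j) \<le> emp_risk (\<rho> j) xs w0) sequentially"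
        using big\<rho>[of t]
      proof eventually_elim
        case (elim j)
        \<comment> \<open>Once \<open>norm (z (\<rho> j))\<close> exceeds \<open>t\<close>, the
          point at distance \<open>t\<close> from \<open>w0\<close> lies on the segment from
          \<open>w0\<close> to \<open>w0 + z (\<rho> j)\<close>, and both ends have empirical risk
          at most that of \<open>w0\<close>.\<close>
        define \<theta> where "\<theta> = t / norm (z (\<rho> j))"
        have "?v j = (1 - \<theta>) *\<^sub>R w0 + \<theta> *\<^sub>R (w0 + z (\<rho> j))"
          by (simp add: \<theta>_def sgn_div_norm algebra_simps divide_inverse)
        also have "emp_risk (\<rho> j) xs \<dots> \<le> emp_risk (\<rho> j) xs w0"
          using elim t le[OF \<rho>(3)] by (intro emp_risk_segment) (auto simp: \<theta>_def divide_le_eq)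
        finally show ?case .
      qed
      from lim[OF \<rho>(1) v this] show ?thesis by simp
    qed
    \<comment> \<open>The unit vector \<open>u\<close> is now both flat and orthogonal to all flat
      directions.\<close>
    then have "AE x in P. u \<bullet> l x = u \<bullet> \<mu>" by (intro flat_direction) auto
    with \<open>u \<in> D\<close> have "u \<in> flat D" by (simp add: flat_def)
    then have "u \<bullet> u = 0" by (rule u_orth)
    with \<open>norm u = 1\<close> show False by simp
  qed
qed

text \<open>The quantifier over \<open>W\<close> stands inside the almost sure statement: one null
  set serves every choice of minimizers, and no measurable selection enters.\<close>

theorem AE_emp_risk_minimizers_tendsto:
  assumes "prob_space M" "prob_space.indep_vars M (\<lambda>_. LX) X UNIV" "\<And>s. distr M LX (X s) = P"
    and D: "subspace D" and w0: "integrable P (k w0)"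
  shows "AE \<omega> in M. \<forall>W. (\<forall>S>0. W S - w0 \<in> D \<and> emp_risk S (\<lambda>s. X s \<omega>) (W S) \<le> emp_risk S (\<lambda>s. X s \<omega>) w0) \<longrightarrow>
    (\<lambda>S. infdist (W S) {w. w - w0 \<in> D \<and> integrable P (k w) \<and> risk w \<le> risk w0}) \<longlonglongrightarrow> 0"
proof -
  obtain Q :: "'a set" where Q: "countable Q" "\<And>U. open U \<Longrightarrow> U \<noteq> {} \<Longrightarrow> \<exists>d\<in>Q. d \<in> U"
    using countable_dense_setE by blast
  have dense: "\<exists>q\<in>Q. norm (w - q) < e" if "0 < e" for w e
    using Q(2)[of "ball w e"] that by (auto simp: dist_norm)
  show ?thesis
    using AE_typical[OF assms(1-3) Q(1)] AE_flat_samples[OF assms(1-3), of D]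
      emp_risk_tendsto[OF assms(1-3) w0]
  proof eventually_elim
    case (elim \<omega>)
    show ?case
    proof (intro allI impI)
      fix W assume "\<forall>S>0. W S - w0 \<in> D \<and> emp_risk S (\<lambda>s. X s \<omega>) (W S) \<le> emp_risk S (\<lambda>s. X s \<omega>) w0"
      with elim show "(\<lambda>S. infdist (W S) {w. w - w0 \<in> D \<and> integrable P (k w) \<and> risk w \<le> risk w0}) \<longlonglongrightarrow> 0"
        by (intro emp_risk_minimizers_tendsto[OF _ dense _ D]) auto
    qed
  qed
qed

section \<open>Logarithms of the risks and attainment of the empirical minimum\<close>

lemma emp_risk_pos: "0 < S \<Longrightarrow> 0 < emp_risk S xs w"
  unfolding emp_risk_def k_def by (intro mult_pos_pos divide_pos_pos sum_pos) auto

lemma ln_emp_risk: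
  assumes "0 < S"
  shows "ln (emp_risk S xs w) = ln ((\<Sum>s<S. k w (xs s)) / real S) - w \<bullet> emp_mean S xs"
proof -
  have "0 < (\<Sum>s<S. k w (xs s)) / real S"
    using assms by (intro divide_pos_pos sum_pos) (auto simp: k_def)
  then show ?thesis unfolding emp_risk_def by (subst ln_mult_pos) auto
qed

lemma integral_k_pos:
  assumes "integrable P (k w)"
  shows "0 < integral\<^sup>L P (k w)"
proof -
  have "integral\<^sup>L P (k w) \<noteq> 0"
    using assms by (subst integral_nonneg_eq_0_iff_AE) (auto simp: k_def)
  moreover have "0 \<le> integral\<^sup>L P (k w)"
    by (intro integral_nonneg_AE) (simp add: k_def)
  ultimately show ?thesis by simp
qed

lemma risk_pos: "integrable P (k w) \<Longrightarrow> 0 < risk w"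
  by (simp add: risk_def integral_k_pos)

lemma ln_risk:
  "integrable P (k w) \<Longrightarrow> ln (risk w) = ln (integral\<^sup>L P (k w)) - w \<bullet> \<mu>"
  unfolding risk_def using integral_k_pos[of w] by (subst ln_mult) auto

text \<open>Centring at the empirical mean makes the coefficient vectors sum to zero, as
  \<open>exp_sum_attains_minimum\<close> requires.\<close>

lemma emp_risk_attains_minimum:
  assumes S: "0 < S" and D: "subspace D"
  shows "\<exists>w. w - w0 \<in> D \<and> (\<forall>v. v - w0 \<in> D \<longrightarrow> emp_risk S xs w \<le> emp_risk S xs v)"
proof -
  have "(\<Sum>s<S. l (xs s) - emp_mean S xs) = 0"
    using S by (simp add: sum_subtractf emp_mean_def sum_constant_scaleR)
  from exp_sum_attains_minimum[OF finite_lessThan D this, of w0 "\<lambda>s. b (xs s)"]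
  show ?thesis
    unfolding emp_risk_altdef using S by (auto intro!: divide_right_mono)
qed

end

subsection \<open>Reconstructed posteriors\<close>

locale reconstruction = statistical_model LX LY px lik
  for LX :: "'x measure" and LY :: "'y measure" and px :: "'x \<Rightarrow> real" and lik :: "'y \<Rightarrow> 'x \<Rightarrow> real" +
  fixes N :: nat and ys :: "nat \<Rightarrow> 'y" and yh :: "'n::finite \<Rightarrow> 'y" and h :: "real^'n \<Rightarrow> real"
  assumes obs: "\<And>j. j < N \<Longrightarrow> ys j \<in> space LY"
    and virtual_obs: "\<And>i. yh i \<in> space LY"
    and obs_pos: "AE x in LX. 0 < px x \<longrightarrow> (\<forall>j<N. 0 < lik (ys j) x)"
    and virtual_obs_pos: "AE x in LX. 0 < px x \<longrightarrow> (\<forall>i. 0 < lik (yh i) x)"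
    and posterior_proper: "integrable LX (\<lambda>x. px x * obs_lik lik N ys x)"
    and base_measure_pos: "\<And>w. feasible N w \<Longrightarrow> 0 < h w"
    and obs_loglik: "integrable (posterior LX px lik N ys) (\<lambda>x. \<Sum>j<N. ln (lik (ys j) x))"
    and virtual_obs_loglik: "\<And>i. integrable (posterior LX px lik N ys) (\<lambda>x. ln (lik (yh i) x))"
begin

section \<open>The posterior as a tilted probability space\<close>

abbreviation post :: "'x measure" where "post \<equiv> posterior LX px lik N ys"

definition virtual_loglik :: "'x \<Rightarrow> real^'n" where "virtual_loglik x = (\<chi> i. ln (lik (yh i) x))"

definition obs_loglikelihood :: "'x \<Rightarrow> real" where "obs_loglikelihood x = (\<Sum>j<N. ln (lik (ys j) x))"

definition Z :: real where "Z = evidence LX px lik N ys"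

definition post_density :: "'x \<Rightarrow> real" where "post_density x = px x * obs_lik lik N ys x / Z"

lemma lik_measurable_section: "y \<in> space LY \<Longrightarrow> lik y \<in> borel_measurable LX"
  using measurable_compose[OF measurable_Pair2' lik_measurable] by (simp add: split_def)

lemma measurable_model[measurable]:
  "px \<in> borel_measurable LX" "j < N \<Longrightarrow> lik (ys j) \<in> borel_measurable LX"
  "lik (yh i) \<in> borel_measurable LX"
  using px_measurable lik_measurable_section obs virtual_obs by auto

lemma obs_lik_measurable[measurable]: "obs_lik lik N ys \<in> borel_measurable LX"
  unfolding obs_lik_def by (intro borel_measurable_prod) auto

lemma weight_lik_measurable[measurable]: "weight_lik lik h yh w \<in> borel_measurable LX"
  unfolding weight_lik_def by measurable

lemma obs_lik_eq_exp: "AE x in LX. 0 < px x \<longrightarrow> obs_lik lik N ys x = exp (obs_loglikelihood x)"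
  using obs_pos by eventually_elim (auto simp: obs_lik_def obs_loglikelihood_def exp_sum intro!: prod.cong)

text \<open>Positivity of the likelihoods is essential: \<open>powr\<close> has value 0 at base 0,
  which is no exponential.\<close>

lemma weight_lik_eq_exp:
  "AE x in LX. 0 < px x \<longrightarrow> weight_lik lik h yh w x = h w * exp (w \<bullet> virtual_loglik x)"
  using virtual_obs_pos
proof eventually_elim
  case (elim x)
  show ?case
  proof
    assume "0 < px x"
    with elim have "lik (yh i) x powr (w $ i) = exp (w $ i * ln (lik (yh i) x))" for i
      by (auto simp: powr_def less_le)
    then show "weight_lik lik h yh w x = h w * exp (w \<bullet> virtual_loglik x)"
      by (simp add: weight_lik_def inner_vec_def virtual_loglik_def exp_sum)
  qed
qed

lemma obs_lik_nonneg: "x \<in> space LX \<Longrightarrow> 0 \<le> px x * obs_lik lik N ys x"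
  unfolding obs_lik_def using px_nonneg lik_nonneg obs by (intro mult_nonneg_nonneg prod_nonneg) auto

text \<open>The likelihood is positive almost everywhere the prior density is, so zero evidence
  would make the prior density vanish, against its normalisation.\<close>

lemma Z_pos: "0 < Z"
proof -
  have "Z \<noteq> 0"
  proof
    assume "Z = 0"
    then have "AE x in LX. px x * obs_lik lik N ys x = 0"
      using posterior_proper obs_lik_nonneg unfolding Z_def evidence_def
      by (subst (asm) integral_nonneg_eq_0_iff_AE) auto
    then have "AE x in LX. ennreal (px x) = 0"
      using obs_lik_eq_exp AE_space
    proof eventually_elim
      case (elim x)
      then show ?case using px_nonneg[of x] by (cases "0 < px x") auto
    qed
    then have "(\<integral>\<^sup>+ x. ennreal (px x) \<partial>LX) = 0"
      by (subst nn_integral_0_iff_AE) auto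
    with px_normalized show False by simp
  qed
  moreover have "0 \<le> Z"
    unfolding Z_def evidence_def using obs_lik_nonneg by (intro integral_nonneg_AE) auto
  ultimately show ?thesis by simp
qed

lemma post_density_measurable[measurable]: "post_density \<in> borel_measurable LX"
  unfolding post_density_def by measurable

lemma post_density_nonneg: "AE x in LX. 0 \<le> post_density x"
  unfolding post_density_def using Z_pos obs_lik_nonneg by (intro AE_I2) simp

lemma post_eq: "post = density LX (\<lambda>x. ennreal (post_density x))"
  by (simp add: posterior_def post_density_def Z_def)

lemma prob_space_post: "prob_space post"
proof (rule prob_spaceI)
  have "(\<integral>\<^sup>+ x. ennreal (post_density x) \<partial>LX) = ennreal (\<integral>x. post_density x \<partial>LX)"
    using posterior_proper post_density_nonneg
    by (intro nn_integral_eq_integral) (auto simp: post_density_def)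
  also have "(\<integral>x. post_density x \<partial>LX) = 1"
    using Z_pos by (simp add: post_density_def Z_def evidence_def)
  finally show "emeasure post (space post) = 1"
    by (simp add: post_eq emeasure_density cong: nn_integral_cong)
qed

lemma virtual_loglik_integrable: "integrable post virtual_loglik"
proof -
  have "virtual_loglik = (\<lambda>x. \<Sum>i\<in>UNIV. ln (lik (yh i) x) *\<^sub>R axis i 1)"
    by (auto simp: virtual_loglik_def vec_eq_iff axis_def if_distrib cong: if_cong)
  then show ?thesis
    using virtual_obs_loglik by (auto intro!: Bochner_Integration.integrable_sum integrable_scaleR_left)
qed

sublocale tilt: exponential_tilting post virtual_loglik obs_loglikelihood
proof (intro exponential_tilting.intro exponential_tilting_axioms.intro prob_space_post virtual_loglik_integrable)
  show "obs_loglikelihood \<in> borel_measurable post"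
    using obs_loglik unfolding obs_loglikelihood_def by (rule borel_measurable_integrable)
qed

lemma post_measurable_iff: "f \<in> borel_measurable post \<longleftrightarrow> f \<in> borel_measurable LX"
  by (simp add: post_eq)

lemma tilt_k_measurable[measurable]: "tilt.k w \<in> borel_measurable LX"
  using tilt.k_measurable[of w] by (simp add: post_measurable_iff)

text \<open>The change of measure behind the reduction: up to the factor \<open>h w * Z\<close>,
  \<open>k w\<close> is the unnormalised reconstructed density relative to the posterior. Where the
  prior density is zero both sides vanish.\<close>

lemma post_density_times_k:
  assumes "feasible N w"
  shows "AE x in LX. weight_lik lik h yh w x * px x = h w * Z * (post_density x * tilt.k w x)"
  using obs_lik_eq_exp weight_lik_eq_exp[of w] AE_space
proof eventually_elim
  case (elim x)
  show ?case
  proof (cases "0 < px x")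
    case True
    with elim Z_pos show ?thesis
      by (simp add: post_density_def tilt.k_def exp_diff)
  next
    case False
    with px_nonneg[of x] elim show ?thesis by (simp add: post_density_def)
  qed
qed

lemma proper_weights_iff:
  assumes w: "feasible N w"
  shows "proper_weights LX px lik h yh w \<longleftrightarrow> integrable post (tilt.k w)"
proof -
  have "proper_weights LX px lik h yh w \<longleftrightarrow> integrable LX (\<lambda>x. h w * Z * (post_density x * tilt.k w x))"
    unfolding proper_weights_def using post_density_times_k[OF w] by (intro integrable_cong_AE) auto
  also have "\<dots> \<longleftrightarrow> integrable LX (\<lambda>x. post_density x * tilt.k w x)"
    using base_measure_pos[OF w] Z_pos by (subst integrable_mult_left_iff) auto
  also have "\<dots> \<longleftrightarrow> integrable post (tilt.k w)"
    unfolding post_eq using post_density_nonneg by (subst integrable_real_density) auto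
  finally show ?thesis .
qed

lemma weight_evidence_eq:
  assumes w: "feasible N w"
  shows "weight_evidence LX px lik h yh w = h w * Z * integral\<^sup>L post (tilt.k w)"
proof -
  have "weight_evidence LX px lik h yh w = (\<integral>x. h w * Z * (post_density x * tilt.k w x) \<partial>LX)"
    unfolding weight_evidence_def using post_density_times_k[OF w] by (intro integral_cong_AE) auto
  also have "\<dots> = h w * Z * integral\<^sup>L post (tilt.k w)"
    unfolding post_eq using post_density_nonneg by (subst integral_real_density) auto
  finally show ?thesis .
qed

section \<open>Divergence and Monte Carlo objective in terms of the risks\<close>

lemma inner_virtual_loglik: "w \<bullet> virtual_loglik x = (\<Sum>i\<in>UNIV. w $ i * ln (lik (yh i) x))"
  by (simp add: inner_vec_def virtual_loglik_def)

lemma objective_post: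
  "objective (integral\<^sup>L post) lik N ys yh w = w \<bullet> tilt.\<mu> - ln (integral\<^sup>L post (tilt.k w))"
proof -
  have "(\<integral>x. w \<bullet> virtual_loglik x \<partial>post) = w \<bullet> tilt.\<mu>"
    unfolding tilt.\<mu>_def by (rule integral_inner_right) (rule virtual_loglik_integrable)
  then show ?thesis
    by (simp add: objective_def tilt.k_def[abs_def] obs_loglikelihood_def inner_virtual_loglik)
qed

text \<open>Normalisation cancels \<open>h w\<close> and \<open>Z\<close>, so the log density ratio
  is \<open>obs_loglikelihood - w \<bullet> virtual_loglik\<close> plus the logarithm of the
  posterior mean of \<open>k w\<close>. Absolute continuity holds because \<open>k w\<close> is
  positive.\<close>

lemma recon_KL_eq:
  assumes w: "feasible N w" and proper: "integrable post (tilt.k w)"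
  shows "recon_KL LX px lik h N ys yh w =
    integral\<^sup>L post obs_loglikelihood - objective (integral\<^sup>L post) lik N ys yh w"
proof -
  let ?K = "integral\<^sup>L post (tilt.k w)"
  define Zw where "Zw = weight_evidence LX px lik h yh w"
  define f where "f x = weight_lik lik h yh w x * px x / Zw" for x
  have h: "0 < h w" by (rule base_measure_pos[OF w])
  have Zw_eq: "Zw = h w * Z * ?K" unfolding Zw_def by (rule weight_evidence_eq[OF w])
  have K: "0 < ?K" by (rule tilt.integral_k_pos[OF proper])
  have Zw: "0 < Zw" using h Z_pos K by (simp add: Zw_eq)
  have f_eq: "AE x in LX. f x = post_density x * tilt.k w x / ?K"
    using post_density_times_k[OF w] h Z_pos K by (auto simp: f_def Zw_eq)
  have [measurable]: "f \<in> borel_measurable LX" unfolding f_def by measurable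
  have kpos: "0 < tilt.k w x" for x by (simp add: tilt.k_def)
  have "recon_KL LX px lik h N ys yh w = KL_divergence (exp 1) (density LX f) (density LX post_density)"
    by (simp add: recon_KL_def recon_posterior_def post_eq f_def[abs_def] Zw_def)
  also have "\<dots> = (\<integral>x. post_density x * log (exp 1) (post_density x / f x) \<partial>LX)"
  proof (rule LX.KL_density_density)
    show "AE x in LX. 0 \<le> f x"
      using f_eq post_density_nonneg by eventually_elim (use kpos K in \<open>simp add: less_imp_le\<close>)
    show "AE x in LX. f x = 0 \<longrightarrow> post_density x = 0"
      using f_eq
    proof eventually_elim
      case (elim x)
      then show ?case using kpos[of x] K by auto
    qed
  qed (use post_density_nonneg in auto)
  also have "\<dots> = (\<integral>x. post_density x * (obs_loglikelihood x - w \<bullet> virtual_loglik x + ln ?K) \<partial>LX)"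
  proof (rule integral_cong_AE)
    show "AE x in LX. post_density x * log (exp 1) (post_density x / f x)
        = post_density x * (obs_loglikelihood x - w \<bullet> virtual_loglik x + ln ?K)"
      using f_eq
    proof eventually_elim
      case (elim x)
      show ?case
      proof (cases "post_density x = 0")
        case False
        then have "post_density x / f x = ?K / tilt.k w x"
          using kpos[of x] K by (simp add: elim)
        also have "ln \<dots> = obs_loglikelihood x - w \<bullet> virtual_loglik x + ln ?K"
          using kpos[of x] K by (subst ln_div) (auto simp: tilt.k_def)
        finally show ?thesis by (simp add: log_def)
      qed simp
    qed
    show "(\<lambda>x. post_density x * (obs_loglikelihood x - w \<bullet> virtual_loglik x + ln ?K)) \<in> borel_measurable LX"
      using tilt.b_measurable tilt.l_measurable unfolding post_measurable_iff
      by (auto simp: post_eq)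
  qed auto
  also have "\<dots> = (\<integral>x. obs_loglikelihood x - w \<bullet> virtual_loglik x + ln ?K \<partial>post)"
    unfolding post_eq using post_density_nonneg tilt.b_measurable tilt.l_measurable
    by (subst integral_real_density) (auto simp: post_eq)
  also have "\<dots> = integral\<^sup>L post obs_loglikelihood - w \<bullet> tilt.\<mu> + ln ?K"
    using obs_loglik virtual_loglik_integrable
    by (simp add: obs_loglikelihood_def[abs_def, symmetric] tilt.\<mu>_def tilt.prob_space)
  finally show ?thesis by (simp add: objective_post)
qed

lemma objective_sample_average:
  assumes "0 < S"
  shows "objective (sample_average S xs) lik N ys yh w = - ln (tilt.emp_risk S xs w)"
proof -
  have "sample_average S xs (\<lambda>x. \<Sum>i\<in>UNIV. w $ i * ln (lik (yh i) x)) = w \<bullet> tilt.emp_mean S xs"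
    by (simp add: sample_average_def tilt.emp_mean_def inner_sum_right inner_virtual_loglik field_simps)
  then show ?thesis
    using assms
    by (simp add: objective_def tilt.ln_emp_risk sample_average_def tilt.k_def obs_loglikelihood_def
        inner_virtual_loglik)
qed

lemma mc_objective_eq:
  assumes "0 < S"
  shows "mc_objective lik N ys yh S xs w = objective (sample_average S xs) lik N ys yh w - ln (real S)"
proof -
  have "0 < (\<Sum>s<S. exp ((\<Sum>i\<in>UNIV. w $ i * ln (lik (yh i) (xs s))) - (\<Sum>j<N. ln (lik (ys j) (xs s)))))"
    using assms by (intro sum_pos) auto
  then show ?thesis
    using assms by (simp add: mc_objective_def objective_def sample_average_def ln_div)
qed

lemma mc_objective_le_iff:
  assumes "0 < S"
  shows "mc_objective lik N ys yh S xs v \<le> mc_objective lik N ys yh S xs w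
    \<longleftrightarrow> tilt.emp_risk S xs w \<le> tilt.emp_risk S xs v"
  using assms tilt.emp_risk_pos[OF assms] by (simp add: mc_objective_eq objective_sample_average)

section \<open>The feasible hyperplane, its tangent space and the two solution sets\<close>

definition directions :: "(real^'n) set" where "directions = {d. (\<Sum>i\<in>UNIV. d $ i) = 0}"

lemma subspace_directions: "subspace directions"
  by (auto simp: subspace_def directions_def sum.distrib sum_distrib_left[symmetric])

lemma feasible_iff_direction:
  "feasible N w0 \<Longrightarrow> feasible N w \<longleftrightarrow> w - w0 \<in> directions"
  by (auto simp: feasible_def directions_def sum_subtractf)

lemma mc_solution_iff:
  assumes "0 < S"
  shows "mc_solution lik N ys yh S xs w \<longleftrightarrow>
    feasible N w \<and> (\<forall>v. feasible N v \<longrightarrow> tilt.emp_risk S xs w \<le> tilt.emp_risk S xs v)"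
  unfolding mc_solution_def is_arg_max_def
  by (simp add: mc_objective_le_iff[OF assms, symmetric]) (meson not_le)

text \<open>Among feasible proper weights the divergence is a constant plus the logarithm of the
  risk. Once one optimum \<open>w0\<close> is given, optimality amounts to having risk at most that
  of \<open>w0\<close>, which is the form of the limit set in the consistency theorem.\<close>

lemma exact_solution_set:
  assumes "exact_solution LX px lik h N ys yh w0"
  shows "{w. exact_solution LX px lik h N ys yh w} =
    {w. w - w0 \<in> directions \<and> integrable post (tilt.k w) \<and> tilt.risk w \<le> tilt.risk w0}"
proof -
  have ex: "exact_solution LX px lik h N ys yh w \<longleftrightarrow> feasible N w \<and> integrable post (tilt.k w) \<and>
      (\<forall>v. feasible N v \<and> integrable post (tilt.k v) \<longrightarrow> tilt.risk w \<le> tilt.risk v)" for w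
  proof -
    have "recon_KL LX px lik h N ys yh v < recon_KL LX px lik h N ys yh w \<longleftrightarrow> tilt.risk v < tilt.risk w"
      if "feasible N w" "integrable post (tilt.k w)" "feasible N v" "integrable post (tilt.k v)" for v
    proof -
      have "recon_KL LX px lik h N ys yh v < recon_KL LX px lik h N ys yh w \<longleftrightarrow> ln (tilt.risk v) < ln (tilt.risk w)"
        using that by (simp add: recon_KL_eq objective_post tilt.ln_risk)
      also have "\<dots> \<longleftrightarrow> tilt.risk v < tilt.risk w"
        using that by (intro ln_less_cancel_iff tilt.risk_pos)
      finally show ?thesis .
    qed
    then show ?thesis
      unfolding exact_solution_def is_arg_min_def using proper_weights_iff by (metis not_le)
  qed
  have w0: "feasible N w0" using assms by (simp add: ex)
  show ?thesis
    using assms unfolding ex feasible_iff_direction[OF w0] by (auto intro: order_trans)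
qed

end

theorem theorem3:
  fixes LX :: "'x measure" and LY :: "'y measure"
    and px :: "'x \<Rightarrow> real" and lik :: "'y \<Rightarrow> 'x \<Rightarrow> real"
    and N :: nat and ys :: "nat \<Rightarrow> 'y"
    and yh :: "'n::finite \<Rightarrow> 'y" and h :: "real^'n \<Rightarrow> real"
    and M :: "'o measure" and X :: "nat \<Rightarrow> 'o \<Rightarrow> 'x"
    and wopt :: "real^'n"
  assumes model: "statistical_model LX LY px lik"
    and obs: "\<And>j. j < N \<Longrightarrow> ys j \<in> space LY"
    and virtual_obs: "\<And>i. yh i \<in> space LY"
    and obs_pos: "AE x in LX. 0 < px x \<longrightarrow> (\<forall>j<N. 0 < lik (ys j) x)"
    and virtual_obs_pos: "AE x in LX. 0 < px x \<longrightarrow> (\<forall>i. 0 < lik (yh i) x)"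
    and posterior_proper: "integrable LX (\<lambda>x. px x * obs_lik lik N ys x)"
    and base_measure_pos: "\<And>w. feasible N w \<Longrightarrow> 0 < h w"
    and obs_loglik: "integrable (posterior LX px lik N ys) (\<lambda>x. \<Sum>j<N. ln (lik (ys j) x))"
    and virtual_obs_loglik: "\<And>i. integrable (posterior LX px lik N ys) (\<lambda>x. ln (lik (yh i) x))"
    and samples_prob: "prob_space M"
    and samples_indep: "prob_space.indep_vars M (\<lambda>_. LX) X UNIV"
    and samples_distr: "\<And>s. distr M LX (X s) = posterior LX px lik N ys"
    and wopt: "exact_solution LX px lik h N ys yh wopt"
  shows "(\<exists>C. \<forall>w. feasible N w \<and> proper_weights LX px lik h yh w \<longrightarrow>
           recon_KL LX px lik h N ys yh w = C - objective (integral\<^sup>L (posterior LX px lik N ys)) lik N ys yh w) \<and>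
     (\<forall>S>0. \<forall>xs w.
           mc_objective lik N ys yh S xs w
             = objective (sample_average S xs) lik N ys yh w - ln (real S)) \<and>
     (\<forall>S>0. \<forall>\<omega>\<in>space M. \<exists>w. mc_solution lik N ys yh S (\<lambda>s. X s \<omega>) w) \<and>
     (\<forall>w. feasible N w \<and> proper_weights LX px lik h yh w \<longrightarrow>
           (AE \<omega> in M. (\<lambda>S. objective (sample_average S (\<lambda>s. X s \<omega>)) lik N ys yh w)
              \<longlonglongrightarrow> objective (integral\<^sup>L (posterior LX px lik N ys)) lik N ys yh w)) \<and>
     (AE \<omega> in M. \<forall>W. (\<forall>S>0. mc_solution lik N ys yh S (\<lambda>s. X s \<omega>) (W S)) \<longrightarrow>
           (\<lambda>S. infdist (W S) {w. exact_solution LX px lik h N ys yh w}) \<longlonglongrightarrow> 0 \<and>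
           ((\<forall>w. exact_solution LX px lik h N ys yh w \<longrightarrow> w = wopt) \<longrightarrow> W \<longlonglongrightarrow> wopt))"
proof -
  interpret statistical_model LX LY px lik by (rule model)
  interpret reconstruction LX LY px lik N ys yh h
    by unfold_locales
      (fact obs virtual_obs obs_pos virtual_obs_pos posterior_proper base_measure_pos obs_loglik virtual_obs_loglik)+
  have feas: "feasible N wopt" and proper: "integrable post (tilt.k wopt)"
    using wopt proper_weights_iff by (auto simp: exact_solution_def is_arg_min_def)
  have dir: "feasible N w \<longleftrightarrow> w - wopt \<in> directions" for w
    by (rule feasible_iff_direction[OF feas])
  show ?thesis
  proof (intro conjI allI impI ballI)
    show "\<exists>C. \<forall>w. feasible N w \<and> proper_weights LX px lik h yh w \<longrightarrow>
        recon_KL LX px lik h N ys yh w = C - objective (integral\<^sup>L post) lik N ys yh w"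
      using recon_KL_eq proper_weights_iff by blast
  next
    fix S :: nat and xs and w :: "real^'n" assume "0 < S"
    then show "mc_objective lik N ys yh S xs w = objective (sample_average S xs) lik N ys yh w - ln (real S)"
      by (rule mc_objective_eq)
  next
    fix S :: nat and \<omega> assume "0 < S"
    then show "\<exists>w. mc_solution lik N ys yh S (\<lambda>s. X s \<omega>) w"
      using tilt.emp_risk_attains_minimum[OF _ subspace_directions] by (simp add: mc_solution_iff dir)
  next
    fix w :: "real^'n" assume w: "feasible N w \<and> proper_weights LX px lik h yh w"
    then have int: "integrable post (tilt.k w)" using proper_weights_iff by blast
    show "AE \<omega> in M. (\<lambda>S. objective (sample_average S (\<lambda>s. X s \<omega>)) lik N ys yh w)
        \<longlonglongrightarrow> objective (integral\<^sup>L post) lik N ys yh w"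
      using tilt.emp_risk_tendsto[OF samples_prob samples_indep samples_distr int]
    proof eventually_elim
      case (elim \<omega>)
      then have lim: "(\<lambda>S. - ln (tilt.emp_risk S (\<lambda>s. X s \<omega>) w)) \<longlonglongrightarrow> - ln (tilt.risk w)"
        using tilt.risk_pos[OF int] by (intro tendsto_intros) auto
      have risk: "- ln (tilt.risk w) = objective (integral\<^sup>L post) lik N ys yh w"
        using int by (simp add: tilt.ln_risk objective_post)
      \<comment> \<open>The identity with the empirical risk is available for \<open>0 < S\<close>
        only, so the limit is transferred along large \<open>S\<close>.\<close>
      have "eventually (\<lambda>S. - ln (tilt.emp_risk S (\<lambda>s. X s \<omega>) w) =
          objective (sample_average S (\<lambda>s. X s \<omega>)) lik N ys yh w) sequentially"
        using eventually_gt_at_top[of 0] by eventually_elim (simp add: objective_sample_average)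
      with lim show ?case unfolding risk by (rule Lim_transform_eventually)
    qed
  next
    show "AE \<omega> in M. \<forall>W. (\<forall>S>0. mc_solution lik N ys yh S (\<lambda>s. X s \<omega>) (W S)) \<longrightarrow>
        (\<lambda>S. infdist (W S) {w. exact_solution LX px lik h N ys yh w}) \<longlonglongrightarrow> 0 \<and>
        ((\<forall>w. exact_solution LX px lik h N ys yh w \<longrightarrow> w = wopt) \<longrightarrow> W \<longlonglongrightarrow> wopt)"
      using tilt.AE_emp_risk_minimizers_tendsto[OF samples_prob samples_indep samples_distr subspace_directions proper]
    proof eventually_elim
      case (elim \<omega>)
      show ?case
      proof (intro allI impI conjI)
        fix W assume W: "\<forall>S>0. mc_solution lik N ys yh S (\<lambda>s. X s \<omega>) (W S)"
        have "W S - wopt \<in> directions \<and>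
            tilt.emp_risk S (\<lambda>s. X s \<omega>) (W S) \<le> tilt.emp_risk S (\<lambda>s. X s \<omega>) wopt" if "0 < S" for S
          using W that feas dir mc_solution_iff[OF that] by blast
        with elim show dist: "(\<lambda>S. infdist (W S) {w. exact_solution LX px lik h N ys yh w}) \<longlonglongrightarrow> 0"
          by (simp add: exact_solution_set[OF wopt])
        assume "\<forall>w. exact_solution LX px lik h N ys yh w \<longrightarrow> w = wopt"
        with wopt have unique: "{w. exact_solution LX px lik h N ys yh w} = {wopt}" by blast
        have "(\<lambda>S. dist (W S) wopt) \<longlonglongrightarrow> 0"
          using dist unfolding unique infdist_singleton .
        then show "W \<longlonglongrightarrow> wopt" by (rule iffD2[OF tendsto_dist_iff])
      qed
    qed
  qed
qed

end
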